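(* Let $d_0,d_2$ be positive integers. Identify a $d_2$-tuple of quadratic forms $\big(\sum_{1\le i\le j\le d_0}c^{(k)}_{ij}x_ix_j\big)_{k=1}^{d_2}\in(\mathrm{Sym}_2(\mathbb{R}^{d_0}))^{d_2}$ with the $d_2$-tuple of symmetric $d_0\times d_0$ matrices $A^{(1)},\dots,A^{(d_2)}$, where $A^{(k)}$ has diagonal entries $A^{(k)}_{ii}=c^{(k)}_{ii}$ and off-diagonal entries $A^{(k)}_{ij}=A^{(k)}_{ji}=\tfrac12c^{(k)}_{ij}$ for $i<j$. The neuromanifold $\mathcal{M}_{(d_0,1,d_2),2}$ consists of the $d_2$-tuples of symmetric $d_0\times d_0$ matrices of rank at most one such that all the rank-1 matrices are multiples of each other. The neuromanifold is equal to the neurovariety $\mathcal{V}_{(d_0,1,d_2),2}$, and the ideal of the neurovariety is generated by the $2\times2$ minors of the $d_0\times d_0d_2$ matrix $$\begin{pmatrix}A^{(1)}&A^{(2)}&\cdots&A^{(d_2)}\end{pmatrix}$$ obtained by placing the $d_2$ symmetric matrices side by side.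
   Context: $\mathrm{Sym}_d(\mathbb{R}^n)$ denotes the real vector space of homogeneous polynomials of degree $d$ in $n$ variables. A polynomial neural network (PNN) with architecture $(\mathbf{d}=(d_0,\dots,d_L),r)$ is the map $p_{\mathbf{w}}=W_L\circ\rho_r\circ W_{L-1}\circ\cdots\circ\rho_r\circ W_1:\mathbb{R}^{d_0}\to\mathbb{R}^{d_L}$, where $W_i\in\mathbb{R}^{d_i\times d_{i-1}}$ are linear maps (weights) $\mathbf{w}=(W_1,\dots,W_L)$ and $\rho_r$ raises each coordinate to the $r$-th power. The parameter map is $\Psi_{\mathbf{d},r}:\mathbf{w}\mapsto p_{\mathbf{w}}\in(\mathrm{Sym}_{r^{L-1}}(\mathbb{R}^{d_0}))^{d_L}$. The neuromanifold $\mathcal{M}_{\mathbf{d},r}$ is the image of $\Psi_{\mathbf{d},r}$; the neurovariety $\mathcal{V}_{\mathbf{d},r}$ is its Zariski closure in $(\mathrm{Sym}_{r^{L-1}}(\mathbb{R}^{d_0}))^{d_L}$. The ideal of the neurovariety is the ideal of all polynomials in the coefficient coordinates (here $c^{(k)}_{ij}$) vanishing on it. *)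

theory Defs
  imports
    "HOL-Library.Poly_Mapping"
    "HOL-Algebra.Ideal"
    "Jordan_Normal_Form.DL_Rank"
    "Jordan_Normal_Form.DL_Submatrix"
begin

section \<open>Real polynomials in the variables \<open>'v\<close>\<close>

text \<open>A monomial is its exponent vector; multiplication of monomials is addition.
  With the ring operations of \<open>HOL-Library.Poly_Mapping\<close> this is the monoid algebra of
  the monomials, i.e. the polynomial ring.\<close>

type_synonym 'v monomial = "'v \<Rightarrow>\<^sub>0 nat"
type_synonym 'v rpoly = "'v monomial \<Rightarrow>\<^sub>0 real"

definition Const :: "real \<Rightarrow> 'v rpoly" where
  "Const a = Poly_Mapping.single 0 a"

definition Var :: "'v \<Rightarrow> 'v rpoly" where
  "Var v = Poly_Mapping.single (Poly_Mapping.single v 1) 1"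

definition eval :: "('v \<Rightarrow> real) \<Rightarrow> 'v rpoly \<Rightarrow> real" where
  "eval x p = (\<Sum>\<alpha>\<in>Poly_Mapping.keys p. Poly_Mapping.lookup p \<alpha> *
     (\<Prod>v\<in>Poly_Mapping.keys \<alpha>. x v ^ Poly_Mapping.lookup \<alpha> v))"

lemma eval_superset:
  assumes "finite S" "Poly_Mapping.keys p \<subseteq> S"
  shows "eval x p = (\<Sum>\<alpha>\<in>S. Poly_Mapping.lookup p \<alpha> *
     (\<Prod>v\<in>Poly_Mapping.keys \<alpha>. x v ^ Poly_Mapping.lookup \<alpha> v))"
  unfolding eval_def using assms
  by (intro sum.mono_neutral_left) (auto simp: in_keys_iff)

lemma eval_add: "eval x (p + q) = eval x p + eval x q"
proof -
  let ?S = "Poly_Mapping.keys p \<union> Poly_Mapping.keys q"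
  have "eval x p = (\<Sum>\<alpha>\<in>?S. Poly_Mapping.lookup p \<alpha> *
     (\<Prod>v\<in>Poly_Mapping.keys \<alpha>. x v ^ Poly_Mapping.lookup \<alpha> v))"
    by (rule eval_superset) auto
  moreover have "eval x q = (\<Sum>\<alpha>\<in>?S. Poly_Mapping.lookup q \<alpha> *
     (\<Prod>v\<in>Poly_Mapping.keys \<alpha>. x v ^ Poly_Mapping.lookup \<alpha> v))"
    by (rule eval_superset) auto
  moreover have "eval x (p + q) = (\<Sum>\<alpha>\<in>?S. Poly_Mapping.lookup (p + q) \<alpha> *
     (\<Prod>v\<in>Poly_Mapping.keys \<alpha>. x v ^ Poly_Mapping.lookup \<alpha> v))"
    by (rule eval_superset) (auto dest: subsetD[OF keys_add])
  ultimately show ?thesis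
    by (simp add: lookup_add distrib_right sum.distrib)
qed

lemma eval_zero: "eval x 0 = 0"
  by (simp add: eval_def)

lemma eval_sum: "eval x (sum f A) = (\<Sum>a\<in>A. eval x (f a))"
  by (induction A rule: infinite_finite_induct) (simp_all add: eval_add eval_zero)

lemma rpoly_as_sum: "p = (\<Sum>\<alpha>\<in>Poly_Mapping.keys p. Poly_Mapping.single \<alpha> (Poly_Mapping.lookup p \<alpha>))"
  by (rule poly_mapping_eqI)
     (auto simp: lookup_sum lookup_single when_def in_keys_iff sum.delta)

lemma eval_single:
  "eval x (Poly_Mapping.single \<alpha> a) = a * (\<Prod>v\<in>Poly_Mapping.keys \<alpha>. x v ^ Poly_Mapping.lookup \<alpha> v)"
  by (cases "a = 0") (simp_all add: eval_def)

lemma eval_single_mult: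
  "eval x (Poly_Mapping.single \<alpha> a * Poly_Mapping.single \<beta> b) =
   eval x (Poly_Mapping.single \<alpha> a) * eval x (Poly_Mapping.single \<beta> b)"
proof -
  have *: "(\<Prod>v\<in>Poly_Mapping.keys \<gamma>. x v ^ Poly_Mapping.lookup \<gamma> v) =
      (\<Prod>v\<in>Poly_Mapping.keys \<alpha> \<union> Poly_Mapping.keys \<beta>. x v ^ Poly_Mapping.lookup \<gamma> v)"
    if "Poly_Mapping.keys \<gamma> \<subseteq> Poly_Mapping.keys \<alpha> \<union> Poly_Mapping.keys \<beta>" for \<gamma> :: "'a monomial"
    using that by (intro prod.mono_neutral_left) (auto simp: in_keys_iff)
  show ?thesis
    unfolding mult_single eval_single *[OF keys_add] *[OF Un_upper1] *[OF Un_upper2]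
    by (simp add: lookup_add power_add prod.distrib)
qed

lemma eval_mult: "eval x (p * q) = eval x p * eval x q"
proof -
  have "eval x (p * q) = eval x
     ((\<Sum>\<alpha>\<in>Poly_Mapping.keys p. Poly_Mapping.single \<alpha> (Poly_Mapping.lookup p \<alpha>)) *
      (\<Sum>\<beta>\<in>Poly_Mapping.keys q. Poly_Mapping.single \<beta> (Poly_Mapping.lookup q \<beta>)))"
    using rpoly_as_sum by metis
  also have "\<dots> =
     (\<Sum>\<alpha>\<in>Poly_Mapping.keys p. eval x (Poly_Mapping.single \<alpha> (Poly_Mapping.lookup p \<alpha>))) *
     (\<Sum>\<beta>\<in>Poly_Mapping.keys q. eval x (Poly_Mapping.single \<beta> (Poly_Mapping.lookup q \<beta>)))"
    by (simp add: sum_product eval_sum eval_single_mult)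
  also have "\<dots> = eval x p * eval x q"
    unfolding eval_sum[symmetric] using rpoly_as_sum by metis
  finally show ?thesis .
qed

lemma eval_Const: "eval x (Const a) = a"
  by (simp add: Const_def eval_single)

lemma eval_Var: "eval x (Var v) = x v"
  by (simp add: Var_def eval_single)

lemma eval_power: "eval x (p ^ k) = eval x p ^ k"
proof (induction k)
  case 0
  have "(1 :: 'a rpoly) = Const 1" by (simp add: Const_def)
  then show ?case by (metis eval_Const power_0)
qed (simp add: eval_mult)

text \<open>The \<open>n\<close> variables \<open>x\<^sub>1, \<dots>, x\<^sub>n\<close> are indexed by \<open>{..<n}\<close>, and likewise all other
  indices start at 0.\<close>

definition monomials :: "nat \<Rightarrow> nat \<Rightarrow> nat monomial set" where
  "monomials n D = {\<alpha>. Poly_Mapping.keys \<alpha> \<subseteq> {..<n} \<and>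
     (\<Sum>i\<in>Poly_Mapping.keys \<alpha>. Poly_Mapping.lookup \<alpha> i) = D}"

definition Sym :: "nat \<Rightarrow> nat \<Rightarrow> nat rpoly set" where
  "Sym n D = {q. Poly_Mapping.keys q \<subseteq> monomials n D}"

definition Sym_tuples :: "nat \<Rightarrow> nat \<Rightarrow> nat \<Rightarrow> nat rpoly vec set" where
  "Sym_tuples n D m = {F \<in> carrier_vec m. \<forall>k<m. F $ k \<in> Sym n D}"


section \<open>Polynomial neural networks\<close>

text \<open>Weights are listed in the order \<open>W\<^sub>1, \<dots>, W\<^sub>L\<close>. The network is defined over an arbitrary
  commutative ring: over \<open>real\<close> it is the map \<open>p\<^sub>w\<close>, and running it over the
  polynomial ring on the vector of variables yields \<open>p\<^sub>w\<close> as a tuple of polynomials.\<close>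

fun pnn :: "nat \<Rightarrow> 'a::comm_ring_1 mat list \<Rightarrow> 'a vec \<Rightarrow> 'a vec" where
  "pnn r [] x = x"
| "pnn r [W] x = W *\<^sub>v x"
| "pnn r (W # W' # Ws) x = pnn r (W' # Ws) (map_vec (\<lambda>t. t ^ r) (W *\<^sub>v x))"

definition weights :: "nat list \<Rightarrow> real mat list set" where
  "weights ds = {Ws. length Ws + 1 = length ds \<and>
     (\<forall>i<length Ws. Ws ! i \<in> carrier_mat (ds ! (i + 1)) (ds ! i))}"

definition param_map :: "nat list \<Rightarrow> nat \<Rightarrow> real mat list \<Rightarrow> nat rpoly vec" where
  "param_map ds r Ws = pnn r (map (map_mat Const) Ws) (vec (hd ds) Var)"

definition neuromanifold :: "nat list \<Rightarrow> nat \<Rightarrow> nat rpoly vec set" where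
  "neuromanifold ds r = param_map ds r ` weights ds"


lemma weights_Cons:
  "W # Ws \<in> weights ds \<longleftrightarrow>
   (\<exists>a b ds'. ds = a # b # ds' \<and> W \<in> carrier_mat b a \<and> Ws \<in> weights (b # ds'))"
proof (cases ds)
  case (Cons a es)
  show ?thesis
    by (cases es) (auto simp: Cons weights_def All_less_Suc2)
qed (simp add: weights_def)

lemma map_vec_eval_mult_mat_vec:
  assumes "W \<in> carrier_mat m n" "v \<in> carrier_vec n"
  shows "map_vec (eval x) (map_mat Const W *\<^sub>v v) = W *\<^sub>v map_vec (eval x) v"
  using assms
  by (intro eq_vecI) (auto simp: scalar_prod_def eval_sum eval_mult eval_Const)

lemma pnn_eval:
  assumes "Ws \<in> weights ds" "v \<in> carrier_vec (hd ds)"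
  shows "map_vec (eval x) (pnn r (map (map_mat Const) Ws) v) = pnn r Ws (map_vec (eval x) v)"
  using assms
proof (induction Ws arbitrary: ds v)
  case (Cons W Ws)
  from Cons.prems(1) obtain a b ds' where ds: "ds = a # b # ds'" and W: "W \<in> carrier_mat b a"
    and Ws: "Ws \<in> weights (b # ds')"
    by (subst (asm) weights_Cons) blast
  from W Cons.prems(2) ds have *: "map_vec (eval x) (map_mat Const W *\<^sub>v v) = W *\<^sub>v map_vec (eval x) v"
    by (intro map_vec_eval_mult_mat_vec) auto
  show ?case
  proof (cases Ws)
    case Nil
    with * show ?thesis by simp
  next
    case (Cons W' Ws')
    let ?u = "map_vec (\<lambda>t. t ^ r) (map_mat Const W *\<^sub>v v)"
    have "map_vec (eval x) (pnn r (map (map_mat Const) Ws) ?u) = pnn r Ws (map_vec (eval x) ?u)"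
      using W Ws by (intro Cons.IH[of "b # ds'"]) (auto intro: carrier_vecI)
    moreover have "map_vec (eval x) ?u = map_vec (\<lambda>t. t ^ r) (map_vec (eval x) (map_mat Const W *\<^sub>v v))"
      by (intro eq_vecI) (auto simp: eval_power)
    ultimately show ?thesis using * Cons by simp
  qed
qed simp

text \<open>The polynomials \<open>param_map ds r Ws\<close> represent the polynomial map \<open>pnn r Ws\<close>.\<close>

lemma eval_param_map:
  assumes "Ws \<in> weights ds" "x \<in> carrier_vec (hd ds)"
  shows "map_vec (eval (\<lambda>i. x $ i)) (param_map ds r Ws) = pnn r Ws x"
proof -
  have "map_vec (eval (\<lambda>i. x $ i)) (vec (hd ds) Var) = x"
    using assms(2) by (intro eq_vecI) (auto simp: eval_Var)
  then show ?thesis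
    unfolding param_map_def using pnn_eval[OF assms(1), of "vec (hd ds) Var"] by simp
qed

lemma monomials_add:
  assumes "\<alpha> \<in> monomials n D" "\<beta> \<in> monomials n E"
  shows "\<alpha> + \<beta> \<in> monomials n (D + E)"
proof -
  have deg: "(\<Sum>i\<in>Poly_Mapping.keys \<gamma>. Poly_Mapping.lookup \<gamma> i) = (\<Sum>i<n. Poly_Mapping.lookup \<gamma> i)"
    if "Poly_Mapping.keys \<gamma> \<subseteq> {..<n}" for \<gamma> :: "nat monomial"
    using that by (intro sum.mono_neutral_left) (auto simp: in_keys_iff)
  have "Poly_Mapping.keys (\<alpha> + \<beta>) \<subseteq> {..<n}"
    using assms keys_add[of \<alpha> \<beta>] by (auto simp: monomials_def)
  then show ?thesis
    using assms deg[of "\<alpha> + \<beta>"] deg[of \<alpha>] deg[of \<beta>]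
    by (simp add: monomials_def lookup_add[of \<alpha> \<beta>] sum.distrib)
qed

lemma zero_monomials: "0 \<in> monomials n 0"
  by (simp add: monomials_def)

lemma Sym_add: "p \<in> Sym n D \<Longrightarrow> q \<in> Sym n D \<Longrightarrow> p + q \<in> Sym n D"
  using keys_add[of p q] by (auto simp: Sym_def)

lemma Sym_sum: "(\<And>a. a \<in> A \<Longrightarrow> f a \<in> Sym n D) \<Longrightarrow> sum f A \<in> Sym n D"
  by (induction A rule: infinite_finite_induct) (auto simp: Sym_add, auto simp: Sym_def)

lemma Sym_mult: "p \<in> Sym n D \<Longrightarrow> q \<in> Sym n E \<Longrightarrow> p * q \<in> Sym n (D + E)"
  using keys_mult[of p q] by (auto simp: Sym_def subset_iff) (metis monomials_add)

lemma Sym_Const: "Const a \<in> Sym n 0"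
  by (auto simp: Sym_def Const_def zero_monomials)

lemma Sym_Var: "i < n \<Longrightarrow> Var i \<in> Sym n 1"
  by (auto simp: Sym_def Var_def monomials_def)

lemma Sym_power: "p \<in> Sym n D \<Longrightarrow> p ^ k \<in> Sym n (D * k)"
proof (induction k)
  case 0
  have "(1 :: nat rpoly) = Const 1" by (simp add: Const_def)
  then show ?case using Sym_Const[of 1 n] by simp
next
  case (Suc k)
  then show ?case using Sym_mult[of p n D "p ^ k" "D * k"] by simp
qed

lemma Sym_tuples_mult_mat_vec:
  assumes "W \<in> carrier_mat m l" "v \<in> Sym_tuples n D l"
  shows "map_mat Const W *\<^sub>v v \<in> Sym_tuples n D m"
proof -
  have "Const (W $$ (k, i)) * v $ i \<in> Sym n D" if "i < l" for k i
    using Sym_mult[OF Sym_Const, of "v $ i" n D] assms(2) that by (simp add: Sym_tuples_def)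
  then show ?thesis
    using assms by (auto simp: Sym_tuples_def scalar_prod_def intro!: Sym_sum)
qed

lemma pnn_Sym_tuples:
  assumes "Ws \<in> weights ds" "Ws \<noteq> []" "v \<in> Sym_tuples n D (hd ds)"
  shows "pnn r (map (map_mat Const) Ws) v \<in> Sym_tuples n (D * r ^ (length Ws - 1)) (last ds)"
  using assms
proof (induction Ws arbitrary: ds v D)
  case (Cons W Ws)
  from Cons.prems(1) obtain a b ds' where ds: "ds = a # b # ds'" and W: "W \<in> carrier_mat b a"
    and Ws: "Ws \<in> weights (b # ds')"
    by (subst (asm) weights_Cons) blast
  have *: "map_mat Const W *\<^sub>v v \<in> Sym_tuples n D b"
    using Sym_tuples_mult_mat_vec[OF W, of v] Cons.prems(3) ds by simp
  show ?case
  proof (cases Ws)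
    case Nil
    with Ws have "ds' = []" by (simp add: weights_def)
    with * Nil ds show ?thesis by simp
  next
    case (Cons W' Ws')
    let ?u = "map_vec (\<lambda>t. t ^ r) (map_mat Const W *\<^sub>v v)"
    have "?u \<in> Sym_tuples n (D * r) b"
      using W * by (auto simp: Sym_tuples_def Sym_power simp del: index_mult_mat_vec intro!: carrier_vecI)
    with Ws Cons have "pnn r (map (map_mat Const) Ws) ?u
        \<in> Sym_tuples n (D * r * r ^ (length Ws - 1)) (last (b # ds'))"
      by (intro Cons.IH) auto
    then show ?thesis using Cons ds by (simp add: mult.assoc)
  qed
qed simp

text \<open>With \<open>L = length ds - 1\<close> layers the outputs have degree \<open>r ^ (L - 1)\<close>.\<close>

lemma neuromanifold_subset:
  assumes "length ds \<ge> 2"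
  shows "neuromanifold ds r \<subseteq> Sym_tuples (hd ds) (r ^ (length ds - 2)) (last ds)"
proof
  fix F assume "F \<in> neuromanifold ds r"
  then obtain Ws where Ws: "Ws \<in> weights ds" and F: "F = param_map ds r Ws"
    by (auto simp: neuromanifold_def)
  from Ws assms have "length Ws = length ds - 1" and "Ws \<noteq> []"
    by (auto simp: weights_def)
  moreover have "vec (hd ds) Var \<in> Sym_tuples (hd ds) 1 (hd ds)"
    using Sym_Var by (simp add: Sym_tuples_def)
  ultimately show "F \<in> Sym_tuples (hd ds) (r ^ (length ds - 2)) (last ds)"
    using pnn_Sym_tuples[OF Ws, of "vec (hd ds) Var" "hd ds" 1 r] F
    by (simp add: param_map_def numeral_2_eq_2)
qed


section \<open>Coefficient coordinates, Zariski closure, vanishing ideal\<close>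

text \<open>The coordinates on \<open>Sym_tuples n D m\<close> are the pairs \<open>(k, \<alpha>)\<close>: the coefficient of the
  monomial \<open>\<alpha>\<close> in the \<open>k\<close>-th polynomial of the tuple.\<close>

type_synonym coord = "nat \<times> nat monomial"

definition coords :: "nat \<Rightarrow> nat \<Rightarrow> nat \<Rightarrow> coord set" where
  "coords n D m = {..<m} \<times> monomials n D"

definition coeffs :: "nat rpoly vec \<Rightarrow> coord \<Rightarrow> real" where
  "coeffs F = (\<lambda>(k, \<alpha>). Poly_Mapping.lookup (F $ k) \<alpha>)"

definition coord_ring :: "nat \<Rightarrow> nat \<Rightarrow> nat \<Rightarrow> coord rpoly ring" where
  "coord_ring n D m =
     \<lparr>carrier = {P. \<forall>\<mu>\<in>Poly_Mapping.keys P. Poly_Mapping.keys \<mu> \<subseteq> coords n D m},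
      monoid.mult = (*), one = 1, zero = 0, add = (+)\<rparr>"

definition zariski_closed :: "nat \<Rightarrow> nat \<Rightarrow> nat \<Rightarrow> nat rpoly vec set \<Rightarrow> bool" where
  "zariski_closed n D m Z \<longleftrightarrow> (\<exists>T \<subseteq> carrier (coord_ring n D m).
     Z = {F \<in> Sym_tuples n D m. \<forall>P\<in>T. eval (coeffs F) P = 0})"

definition vanishing_ideal ::
  "nat \<Rightarrow> nat \<Rightarrow> nat \<Rightarrow> nat rpoly vec set \<Rightarrow> coord rpoly set" where
  "vanishing_ideal n D m Z =
     {P \<in> carrier (coord_ring n D m). \<forall>F\<in>Z. eval (coeffs F) P = 0}"

definition neurovariety :: "nat list \<Rightarrow> nat \<Rightarrow> nat rpoly vec set" where
  "neurovariety ds r =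
     zariski_closed (hd ds) (r ^ (length ds - 2)) (last ds) hull neuromanifold ds r"

definition neurovariety_ideal :: "nat list \<Rightarrow> nat \<Rightarrow> coord rpoly set" where
  "neurovariety_ideal ds r =
     vanishing_ideal (hd ds) (r ^ (length ds - 2)) (last ds) (neurovariety ds r)"


section \<open>Quadratic forms and symmetric matrices\<close>

text \<open>The coefficient \<open>c\<^sub>i\<^sub>j\<close> of \<open>x\<^sub>i x\<^sub>j\<close> is the one of \<open>quad_monomial i j\<close>, for either order of
  \<open>i\<close> and \<open>j\<close>; it enters the symmetric matrix halved off the diagonal. \<open>generic_quad_mat n k\<close> is
  the \<open>k\<close>-th matrix with coordinate functions as entries, and \<open>generic_flattening n m\<close> places the
  \<open>m\<close> of them side by side.\<close>

definition quad_monomial :: "nat \<Rightarrow> nat \<Rightarrow> nat monomial" where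
  "quad_monomial i j = Poly_Mapping.single i 1 + Poly_Mapping.single j 1"

definition quad_mat :: "nat \<Rightarrow> nat rpoly \<Rightarrow> real mat" where
  "quad_mat n q = mat n n (\<lambda>(i, j).
     if i = j then Poly_Mapping.lookup q (quad_monomial i i)
     else 1 / 2 * Poly_Mapping.lookup q (quad_monomial i j))"

definition generic_quad_mat :: "nat \<Rightarrow> nat \<Rightarrow> coord rpoly mat" where
  "generic_quad_mat n k = mat n n (\<lambda>(i, j).
     if i = j then Var (k, quad_monomial i i)
     else Const (1 / 2) * Var (k, quad_monomial i j))"

definition generic_flattening :: "nat \<Rightarrow> nat \<Rightarrow> coord rpoly mat" where
  "generic_flattening n m = mat n (n * m) (\<lambda>(i, l).
     generic_quad_mat n (l div n) $$ (i, l mod n))"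

definition minors :: "nat \<Rightarrow> 'a::comm_ring_1 mat \<Rightarrow> 'a set" where
  "minors s A = {det (submatrix A I J) | I J.
     I \<subseteq> {..<dim_row A} \<and> J \<subseteq> {..<dim_col A} \<and> card I = s \<and> card J = s}"

abbreviation mat_rank :: "real mat \<Rightarrow> nat" where
  "mat_rank A \<equiv> vec_space.rank (dim_row A) A"

lemma quad_monomial_commute: "quad_monomial i j = quad_monomial j i"
  by (simp add: quad_monomial_def add.commute)

lemma quad_monomial_eq_iff:
  "quad_monomial i j = quad_monomial i' j' \<longleftrightarrow> (i = i' \<and> j = j') \<or> (i = j' \<and> j = i')"
proof
  assume *: "quad_monomial i j = quad_monomial i' j'"
  have "(1 when i = t) + (1 when j = t) = (1 when i' = t) + ((1::nat) when j' = t)" for t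
    using arg_cong[OF *, of "\<lambda>\<alpha>. Poly_Mapping.lookup \<alpha> t"]
    by (simp add: quad_monomial_def lookup_add lookup_single)
  from this[of i] this[of j] this[of i'] show "(i = i' \<and> j = j') \<or> (i = j' \<and> j = i')"
    by (auto simp: when_def split: if_splits)
qed (auto simp: quad_monomial_commute)

lemma monomials_2: "monomials n 2 = {quad_monomial i j | i j. i < n \<and> j < n}"
proof (intro equalityI subsetI)
  fix \<alpha> assume \<alpha>: "\<alpha> \<in> monomials n 2"
  have split: "\<exists>\<beta> i. \<gamma> = \<beta> + Poly_Mapping.single i 1 \<and> i < n \<and> \<beta> \<in> monomials n d"
    if \<gamma>: "\<gamma> \<in> monomials n (Suc d)" for \<gamma> d
  proof -
    have "(\<Sum>i\<in>Poly_Mapping.keys \<gamma>. Poly_Mapping.lookup \<gamma> i) \<noteq> 0"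
      using \<gamma> by (auto simp: monomials_def)
    then obtain i where i: "i \<in> Poly_Mapping.keys \<gamma>" by (metis sum.empty ex_in_conv)
    define \<beta> where "\<beta> = \<gamma> - Poly_Mapping.single i 1"
    have eq: "\<gamma> = \<beta> + Poly_Mapping.single i 1"
      using i by (intro poly_mapping_eqI)
        (auto simp: \<beta>_def lookup_add lookup_minus lookup_single when_def in_keys_iff)
    have sub: "Poly_Mapping.keys \<beta> \<subseteq> Poly_Mapping.keys \<gamma>"
      by (auto simp: eq in_keys_iff lookup_add)
    have "(\<Sum>i\<in>Poly_Mapping.keys \<gamma>. Poly_Mapping.lookup \<gamma> i) =
        (\<Sum>i\<in>Poly_Mapping.keys \<gamma>. Poly_Mapping.lookup \<beta> i) + 1"
      using i by (subst eq) (simp add: lookup_add sum.distrib lookup_single when_def sum.delta)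
    moreover have "(\<Sum>i\<in>Poly_Mapping.keys \<gamma>. Poly_Mapping.lookup \<beta> i) =
        (\<Sum>i\<in>Poly_Mapping.keys \<beta>. Poly_Mapping.lookup \<beta> i)"
      using sub by (intro sum.mono_neutral_right) (auto simp: in_keys_iff)
    ultimately have "\<beta> \<in> monomials n d" using \<gamma> sub by (auto simp: monomials_def)
    with eq i \<gamma> show ?thesis by (auto simp: monomials_def)
  qed
  from split[of \<alpha> 1] \<alpha> obtain \<beta> j where \<beta>: "\<alpha> = \<beta> + Poly_Mapping.single j 1" "j < n" "\<beta> \<in> monomials n 1"
    by (auto simp: numeral_2_eq_2)
  from split[of \<beta> 0] \<beta>(3) obtain \<gamma> i where "\<beta> = \<gamma> + Poly_Mapping.single i 1" "i < n" "\<gamma> \<in> monomials n 0"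
    by auto
  moreover have "\<gamma> = 0" if "\<gamma> \<in> monomials n 0" for \<gamma>
    using that by (intro poly_mapping_eqI) (auto simp: monomials_def in_keys_iff)
  ultimately show "\<alpha> \<in> {quad_monomial i j | i j. i < n \<and> j < n}"
    using \<beta> by (fastforce simp: quad_monomial_def)
next
  fix \<alpha> assume "\<alpha> \<in> {quad_monomial i j | i j. i < n \<and> j < n}"
  moreover have "Poly_Mapping.single i (1::nat) \<in> monomials n 1" if "i < n" for i
    using that by (simp add: monomials_def)
  ultimately show "\<alpha> \<in> monomials n 2"
    using monomials_add[of _ n 1 _ 1] by (auto simp: quad_monomial_def numeral_2_eq_2)
qed

text \<open>The identification of quadratic forms with symmetric matrices.\<close>

lemma quad_mat_bij:
  "bij_betw (quad_mat n) (Sym n 2) {A \<in> carrier_mat n n. transpose_mat A = A}"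
  unfolding bij_betw_def
proof
  show "inj_on (quad_mat n) (Sym n 2)"
  proof
    fix p q assume pq: "p \<in> Sym n 2" "q \<in> Sym n 2" and eq: "quad_mat n p = quad_mat n q"
    show "p = q"
    proof (rule poly_mapping_eqI)
      fix \<alpha>
      show "Poly_Mapping.lookup p \<alpha> = Poly_Mapping.lookup q \<alpha>"
      proof (cases "\<alpha> \<in> monomials n 2")
        case True
        then obtain i j where ij: "i < n" "j < n" "\<alpha> = quad_monomial i j"
          by (auto simp: monomials_2)
        with arg_cong[OF eq, of "\<lambda>A. A $$ (i, j)"] show ?thesis
          by (auto simp: quad_mat_def split: if_splits)
      next
        case False
        with pq have "Poly_Mapping.lookup p \<alpha> = 0" "Poly_Mapping.lookup q \<alpha> = 0"
          by (auto simp: Sym_def in_keys_iff subset_iff)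
        then show ?thesis by simp
      qed
    qed
  qed
  show "quad_mat n ` Sym n 2 = {A \<in> carrier_mat n n. transpose_mat A = A}"
  proof (intro equalityI subsetI)
    fix A assume "A \<in> quad_mat n ` Sym n 2"
    then show "A \<in> {A \<in> carrier_mat n n. transpose_mat A = A}"
      by (auto simp: quad_mat_def quad_monomial_commute intro!: eq_matI)
  next
    fix A :: "real mat" assume "A \<in> {A \<in> carrier_mat n n. transpose_mat A = A}"
    then have A: "A \<in> carrier_mat n n" and T: "transpose_mat A = A" by auto
    have sym: "A $$ (j, i) = A $$ (i, j)" if "i < n" "j < n" for i j
      using that A arg_cong[OF T, of "\<lambda>A. A $$ (i, j)"] by auto
    define q where "q = (\<Sum>(i, j)\<in>{..<n} \<times> {..<n}. Poly_Mapping.single (quad_monomial i j) (A $$ (i, j)))"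
    have look: "Poly_Mapping.lookup q (quad_monomial i j) =
        (if i = j then 1 else 2) * A $$ (i, j)" if "i < n" "j < n" for i j
    proof -
      have "Poly_Mapping.lookup q (quad_monomial i j) =
          (\<Sum>x\<in>{..<n} \<times> {..<n}. if x = (i, j) \<or> x = (j, i) then A $$ x else 0)"
        unfolding q_def lookup_sum
        by (intro sum.cong) (auto simp: lookup_single when_def quad_monomial_eq_iff split: if_splits)
      also have "\<dots> = (\<Sum>x\<in>{(i, j), (j, i)}. A $$ x)"
        using that by (intro sum.mono_neutral_cong_right) auto
      also have "\<dots> = (if i = j then 1 else 2) * A $$ (i, j)"
        using sym that by auto
      finally show ?thesis .
    qed
    have "q \<in> Sym n 2"
    proof -
      have "quad_monomial i j \<in> monomials n 2" if "i < n" "j < n" for i j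
        using that by (auto simp: monomials_2)
      then show ?thesis
        unfolding q_def by (intro Sym_sum) (auto simp: Sym_def split: if_splits)
    qed
    moreover have "A = quad_mat n q"
      using A by (intro eq_matI) (auto simp: quad_mat_def look)
    ultimately show "A \<in> quad_mat n ` Sym n 2" by blast
  qed
qed

lemma cring_coord_ring: "cring (coord_ring n D m)"
proof -
  let ?C = "{P :: coord rpoly. \<forall>\<mu>\<in>Poly_Mapping.keys P. Poly_Mapping.keys \<mu> \<subseteq> coords n D m}"
  have add: "P + Q \<in> ?C" if "P \<in> ?C" "Q \<in> ?C" for P Q
    using that keys_add[of P Q] by fastforce
  have mult: "P * Q \<in> ?C" if PQ: "P \<in> ?C" "Q \<in> ?C" for P Q
  proof (intro CollectI ballI)
    fix \<mu> assume "\<mu> \<in> Poly_Mapping.keys (P * Q)"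
    then obtain a b where "\<mu> = a + b" "a \<in> Poly_Mapping.keys P" "b \<in> Poly_Mapping.keys Q"
      using keys_mult[of P Q] by blast
    then show "Poly_Mapping.keys \<mu> \<subseteq> coords n D m"
      using PQ keys_add[of a b] by blast
  qed
  have neg: "- P \<in> ?C" if "P \<in> ?C" for P
    using that by (auto simp: in_keys_iff)
  have neg': "\<exists>Q\<in>?C. Q + P = 0" if "P \<in> ?C" for P
    using neg[OF that] by (intro bexI[of _ "- P"]) auto
  have zero: "0 \<in> ?C" and one: "1 \<in> ?C"
    by auto
  have "abelian_group (coord_ring n D m)"
    by (rule abelian_groupI; unfold coord_ring_def ring_record_simps)
       (rule add zero neg' add.assoc add.commute add_0_left; assumption?)+
  moreover have "comm_monoid (coord_ring n D m)"
    by (rule comm_monoidI; unfold coord_ring_def ring_record_simps)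
       (rule mult one mult.assoc mult.commute mult_1_left; assumption?)+
  ultimately show ?thesis
    by (rule cringI) (simp add: coord_ring_def distrib_right)
qed

end

theory Submission
  imports Defs "Jordan_Normal_Form.DL_Rank_Submatrix"
begin

text \<open>Modulo the \<open>2 \<times> 2\<close> minors of the flattening, two indices occurring in a product of
  matrix entries can be exchanged. Hence, modulo the ideal of minors, such a product depends only
  on the multiset of its matrix numbers and the multiset of its indices, i.e. on the monomial
  that it becomes under the parametrization by the matrices \<open>b k * a i * a j\<close>. If a
  polynomial vanishes on the image of the parametrization, then the coefficients belonging to
  each such monomial sum to zero, so the polynomial lies in the ideal.\<close>

section \<open>Minors of size two\<close>

text \<open>The minors are binomials in the matrix entries, whereas an off-diagonal coordinate is
  twice an entry. Coordinate monomials are therefore rewritten as scalar multiples of products of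
  entries before any exchange is made. That the coefficients of each parameter monomial sum to zero
  requires distinct monomials in \<open>a\<close> and \<open>b\<close> to be linearly independent as
  functions on real parameters. This comes from the independence of characters: every such monomial
  is multiplicative under the componentwise product of parameters. Closedness of the neuromanifold
  is a separate pointwise argument: a tuple at which all minors vanish already has the form
  \<open>b k * a i * a j\<close> over the reals. A real symmetric rank-one matrix is an outer square
  only up to sign; taking for \<open>a\<close> a row of one of the matrices and leaving sign and
  scale to \<open>b k\<close> avoids square roots and keeps the solution real.\<close>

lemma det_2x2:
  assumes "A \<in> carrier_mat 2 2"
  shows "det A = A $$ (0, 0) * A $$ (1, 1) - A $$ (0, 1) * A $$ (1, 0)"
proof -
  have "det (mat_delete A 0 j) = A $$ (1, 1 - j)" if "j < 2" for j
    using that assms by (subst det_single) (auto simp: mat_delete_def less_2_cases_iff)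
  then have "(\<Sum>j<2. A $$ (0, j) * cofactor A 0 j) =
      A $$ (0, 0) * A $$ (1, 1) - A $$ (0, 1) * A $$ (1, 0)"
    by (simp add: cofactor_def numeral_2_eq_2)
  then show ?thesis
    using laplace_expansion_row[OF assms, of 0] by simp
qed

lemma pick_pair:
  fixes i i' :: nat
  assumes "i < i'"
  shows "pick {i, i'} 0 = i" "pick {i, i'} (Suc 0) = i'"
proof -
  have "{a \<in> {i, i'}. a < i} = {}" "{a \<in> {i, i'}. a < i'} = {i}"
    using assms by auto
  then have "card {a \<in> {i, i'}. a < i} = 0" "card {a \<in> {i, i'}. a < i'} = Suc 0"
    by (simp_all only: card.empty card_1_singleton_iff) blast
  then show "pick {i, i'} 0 = i" "pick {i, i'} (Suc 0) = i'"
    using pick_card_in_set[of i "{i, i'}"] pick_card_in_set[of i' "{i, i'}"]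
    by (metis insertI1 insertI2)+
qed

lemma det_submatrix_pair:
  assumes "i < i'" "i' < dim_row A" "j < j'" "j' < dim_col A"
  shows "det (submatrix A {i, i'} {j, j'}) =
    A $$ (i, j) * A $$ (i', j') - A $$ (i, j') * A $$ (i', j)"
proof -
  have "{a. a < dim_row A \<and> a \<in> {i, i'}} = {i, i'}" "{a. a < dim_col A \<and> a \<in> {j, j'}} = {j, j'}"
    using assms by auto
  then have card: "card {a. a < dim_row A \<and> a \<in> {i, i'}} = 2" "card {a. a < dim_col A \<and> a \<in> {j, j'}} = 2"
    using assms by simp_all
  then have "submatrix A {i, i'} {j, j'} \<in> carrier_mat 2 2"
    by (intro carrier_matI) (simp_all only: dim_submatrix)
  then show ?thesis
    using assms card by (simp add: det_2x2 submatrix_index pick_pair del: pick.simps)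
qed

text \<open>A set of two row or column numbers has a unique increasing listing, which fixes the sign
  of the determinant.\<close>

lemma minors_2:
  "minors 2 A = {A $$ (i, j) * A $$ (i', j') - A $$ (i, j') * A $$ (i', j) | i i' j j'.
     i < i' \<and> i' < dim_row A \<and> j < j' \<and> j' < dim_col A}"
    (is "_ = ?R")
proof (intro equalityI subsetI)
  have pair: "\<exists>i i'. S = {i, i'} \<and> i < i'" if "card S = 2" for S :: "nat set"
    using that by (metis card_2_iff insert_commute linorder_neqE_nat)
  fix d assume "d \<in> minors 2 A"
  then obtain I J where IJ: "d = det (submatrix A I J)" "I \<subseteq> {..<dim_row A}" "J \<subseteq> {..<dim_col A}"
    "card I = 2" "card J = 2"
    by (auto simp: minors_def)
  with pair obtain i i' j j' where "I = {i, i'}" "i < i'" "J = {j, j'}" "j < j'"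
    by meson
  with IJ show "d \<in> ?R"
    using det_submatrix_pair[of i i' A j j'] by auto
next
  fix d assume "d \<in> ?R"
  then obtain i i' j j' where ij: "i < i'" "i' < dim_row A" "j < j'" "j' < dim_col A"
    and d: "d = A $$ (i, j) * A $$ (i', j') - A $$ (i, j') * A $$ (i', j)"
    by blast
  from det_submatrix_pair[OF ij] d have "d = det (submatrix A {i, i'} {j, j'})"
    by simp
  moreover have "{i, i'} \<subseteq> {..<dim_row A}" "{j, j'} \<subseteq> {..<dim_col A}"
    "card {i, i'} = 2" "card {j, j'} = 2"
    using ij by auto
  ultimately show "d \<in> minors 2 A"
    unfolding minors_def by blast
qed

text \<open>Equal rows or columns give zero, and reversing an order changes only the sign, so no
  ordering of the indices remains to be tracked. \<open>J\<close> stays abstract because it is later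
  \<open>{0}\<close>, an ideal, or the kernel of an evaluation.\<close>

lemma minors_2_subsetD:
  assumes "minors 2 A \<subseteq> J" "0 \<in> J" and neg: "\<And>x. x \<in> J \<Longrightarrow> - x \<in> J"
    and "i < dim_row A" "i' < dim_row A" "j < dim_col A" "j' < dim_col A"
  shows "A $$ (i, j) * A $$ (i', j') - A $$ (i, j') * A $$ (i', j) \<in> J"
proof -
  let ?d = "\<lambda>i i' j j'. A $$ (i, j) * A $$ (i', j') - A $$ (i, j') * A $$ (i', j)"
  have sorted: "?d i i' j j' \<in> J" if "i < i'" "i' < dim_row A" "j < j'" "j' < dim_col A" for i i' j j'
    using that assms(1) unfolding minors_2 by blast
  have rows: "?d i i' j j' \<in> J" if "i < i'" "i' < dim_row A" "j < dim_col A" "j' < dim_col A" for i i' j j'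
  proof (cases j j' rule: linorder_cases)
    case less
    then show ?thesis using sorted that by simp
  next
    case equal
    then show ?thesis using assms(2) by simp
  next
    case greater
    then show ?thesis using neg[OF sorted[of i i' j' j]] that by simp
  qed
  show ?thesis
  proof (cases i i' rule: linorder_cases)
    case less
    then show ?thesis using rows assms by simp
  next
    case equal
    then show ?thesis using assms(2) by (simp add: mult.commute)
  next
    case greater
    then show ?thesis using neg[OF rows[of i' i j j']] assms by (simp add: mult.commute)
  qed
qed

text \<open>A nonzero minor of size two would force rank at least two.\<close>

lemma mat_rank_le_1D:
  fixes A :: "real mat"
  assumes "mat_rank A \<le> 1" "i < dim_row A" "i' < dim_row A" "j < dim_col A" "j' < dim_col A"
  shows "A $$ (i, j) * A $$ (i', j') = A $$ (i, j') * A $$ (i', j)"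
proof -
  have "d = 0" if "d \<in> minors 2 A" for d
  proof (rule ccontr)
    assume "d \<noteq> 0"
    from that obtain I J where IJ: "d = det (submatrix A I J)" "J \<subseteq> {..<dim_col A}" "card J = 2"
      by (auto simp: minors_def)
    from \<open>d \<noteq> 0\<close> IJ(1) have "card {j. j < dim_col A \<and> j \<in> J} \<le> mat_rank A"
      by (intro vec_space.rank_gt_minor) auto
    moreover have "{j. j < dim_col A \<and> j \<in> J} = J"
      using IJ(2) by auto
    ultimately show False using assms(1) IJ(3) by simp
  qed
  then have "A $$ (i, j) * A $$ (i', j') - A $$ (i, j') * A $$ (i', j) \<in> {0}"
    using assms by (intro minors_2_subsetD) auto
  then show ?thesis by simp
qed

lemma mat_rank_eq_0D:
  fixes A :: "real mat"
  assumes "mat_rank A = 0" "i < dim_row A" "j < dim_col A"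
  shows "A $$ (i, j) = 0"
proof (rule ccontr)
  assume "A $$ (i, j) \<noteq> 0"
  have pick: "pick {l} 0 = l" for l :: nat
    by (simp add: Least_equality)
  have "{a. a < dim_row A \<and> a \<in> {i}} = {i}" "{a. a < dim_col A \<and> a \<in> {j}} = {j}"
    using assms by auto
  then have card: "card {a. a < dim_row A \<and> a \<in> {i}} = 1" "card {a. a < dim_col A \<and> a \<in> {j}} = 1"
    by simp_all
  then have "submatrix A {i} {j} \<in> carrier_mat 1 1"
    by (intro carrier_matI) (simp_all only: dim_submatrix)
  then have "det (submatrix A {i} {j}) = A $$ (i, j)"
    using card by (simp add: det_single submatrix_index pick del: pick.simps)
  with \<open>A $$ (i, j) \<noteq> 0\<close> have "card {a. a < dim_col A \<and> a \<in> {j}} \<le> mat_rank A"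
    by (intro vec_space.rank_gt_minor[where I = "{i}"]) auto
  with card assms(1) show False by simp
qed


section \<open>The neuromanifold\<close>

lemma Const_mult_single: "Const a * Poly_Mapping.single \<alpha> b = Poly_Mapping.single \<alpha> (a * b)"
  by (simp add: Const_def mult_single)

lemma Const_add: "Const (a + b) = Const a + Const b"
  by (simp add: Const_def single_add)

lemma Const_mult: "Const (a * b) = Const a * Const b"
  by (simp add: Const_def mult_single)

lemma Const_0 [simp]: "Const 0 = 0"
  by (simp add: Const_def)

lemma Const_sum: "Const (sum f A) = (\<Sum>a\<in>A. Const (f a))"
  by (induction A rule: infinite_finite_induct) (simp_all add: Const_add)

lemma Const_1 [simp]: "Const 1 = 1"
  by (simp add: Const_def)

lemma square_linear_form:
  "(\<Sum>i<n. Const (a i) * Var i) ^ 2 =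
   (\<Sum>(i, j)\<in>{..<n} \<times> {..<n}. Poly_Mapping.single (quad_monomial i j) (a i * a j))"
  by (simp add: power2_eq_square sum_product sum.cartesian_product Var_def Const_mult_single
      mult_single quad_monomial_def)

text \<open>Off the diagonal both (i, j) and (j, i) contribute to the same monomial; the resulting
  factor 2 is what the halving in \<open>quad_mat\<close> undoes.\<close>

lemma lookup_quadratic_form:
  assumes "i < n" "j < n" "\<And>i j. f i j = f j i"
  shows "Poly_Mapping.lookup
      (\<Sum>(i, j)\<in>{..<n} \<times> {..<n}. Poly_Mapping.single (quad_monomial i j) (f i j)) (quad_monomial i j) =
    (if i = j then 1 else 2) * (f i j :: real)"
proof -
  have "Poly_Mapping.lookup
      (\<Sum>(i, j)\<in>{..<n} \<times> {..<n}. Poly_Mapping.single (quad_monomial i j) (f i j)) (quad_monomial i j) =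
      (\<Sum>x\<in>{..<n} \<times> {..<n}. if x = (i, j) \<or> x = (j, i) then f (fst x) (snd x) else 0)"
    unfolding lookup_sum
    by (intro sum.cong) (auto simp: lookup_single when_def quad_monomial_eq_iff split: if_splits)
  also have "\<dots> = (\<Sum>x\<in>{(i, j), (j, i)}. f (fst x) (snd x))"
    using assms(1,2) by (intro sum.mono_neutral_cong_right) auto
  also have "\<dots> = (if i = j then 1 else 2) * f i j"
    using assms(3)[of j i] by auto
  finally show ?thesis .
qed

lemma quad_mat_scaled_square:
  assumes "i < n" "j < n"
  shows "quad_mat n (Const b * (\<Sum>i<n. Const (a i) * Var i) ^ 2) $$ (i, j) = b * a i * a j"
proof -
  have "Const b * (\<Sum>i<n. Const (a i) * Var i) ^ 2 =
      (\<Sum>(i, j)\<in>{..<n} \<times> {..<n}. Poly_Mapping.single (quad_monomial i j) (b * a i * a j))"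
    by (simp add: square_linear_form sum_distrib_left case_prod_beta Const_mult_single mult.assoc)
  then show ?thesis
    using assms by (simp add: quad_mat_def lookup_quadratic_form)
qed

lemma quad_mat_param_map:
  assumes "W1 \<in> carrier_mat 1 n" "W2 \<in> carrier_mat m 1" "k < m" "i < n" "j < n"
  shows "quad_mat n (param_map [n, 1, m] 2 [W1, W2] $ k) $$ (i, j) =
    W2 $$ (k, 0) * W1 $$ (0, i) * W1 $$ (0, j)"
proof -
  have "param_map [n, 1, m] 2 [W1, W2] $ k =
      Const (W2 $$ (k, 0)) * (\<Sum>i<n. Const (W1 $$ (0, i)) * Var i) ^ 2"
    using assms(1-3) by (simp add: param_map_def scalar_prod_def lessThan_atLeast0)
  then show ?thesis
    using assms(4,5) by (simp add: quad_mat_scaled_square)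
qed

lemma quad_mat_eqI:
  assumes "p \<in> Sym n 2" "q \<in> Sym n 2"
    "\<And>i j. i < n \<Longrightarrow> j < n \<Longrightarrow> quad_mat n p $$ (i, j) = quad_mat n q $$ (i, j)"
  shows "p = q"
proof -
  have "quad_mat n p = quad_mat n q"
    using assms(3) by (intro eq_matI) (auto simp: quad_mat_def)
  with quad_mat_bij[of n] assms(1,2) show ?thesis
    by (auto simp: bij_betw_def inj_on_def)
qed

lemma neuromanifold_Sym_tuples: "neuromanifold [n, 1, m] 2 \<subseteq> Sym_tuples n 2 m"
  using neuromanifold_subset[of "[n, 1, m]" 2] by simp

lemma weights_1_iff:
  "Ws \<in> weights [n, 1, m] \<longleftrightarrow>
    (\<exists>W1 W2. Ws = [W1, W2] \<and> W1 \<in> carrier_mat 1 n \<and> W2 \<in> carrier_mat m 1)"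
  by (auto simp: weights_def length_Suc_conv less_Suc_eq numeral_2_eq_2)

text \<open>With one hidden neuron the network squares a single linear form and rescales it for each
  output: \<open>a\<close> is the only row of the first weight matrix and \<open>b\<close> the only
  column of the second.\<close>

lemma neuromanifold_exists:
  fixes a b :: "nat \<Rightarrow> real"
  obtains F where "F \<in> neuromanifold [n, 1, m] 2"
    "\<And>k i j. k < m \<Longrightarrow> i < n \<Longrightarrow> j < n \<Longrightarrow> quad_mat n (F $ k) $$ (i, j) = b k * a i * a j"
proof
  let ?W = "[mat 1 n (\<lambda>(_, i). a i), mat m 1 (\<lambda>(k, _). b k)]"
  have "?W \<in> weights [n, 1, m]"
    unfolding weights_1_iff by auto
  then show "param_map [n, 1, m] 2 ?W \<in> neuromanifold [n, 1, m] 2"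
    unfolding neuromanifold_def by (rule imageI)
  show "quad_mat n (param_map [n, 1, m] 2 ?W $ k) $$ (i, j) = b k * a i * a j"
    if "k < m" "i < n" "j < n" for k i j
    using that by (subst quad_mat_param_map[of _ n _ m]) auto
qed

lemma neuromanifold_iff:
  "F \<in> neuromanifold [n, 1, m] 2 \<longleftrightarrow> F \<in> Sym_tuples n 2 m \<and>
    (\<exists>a b. \<forall>k<m. \<forall>i<n. \<forall>j<n. quad_mat n (F $ k) $$ (i, j) = b k * a i * a j)"
proof (intro iffI conjI; (elim conjE exE)?)
  assume F: "F \<in> neuromanifold [n, 1, m] 2"
  then show "F \<in> Sym_tuples n 2 m"
    using neuromanifold_Sym_tuples by blast
  from F obtain W1 W2 where "F = param_map [n, 1, m] 2 [W1, W2]"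
    "W1 \<in> carrier_mat 1 n" "W2 \<in> carrier_mat m 1"
    unfolding neuromanifold_def image_iff Bex_def weights_1_iff by blast
  then have "\<forall>k<m. \<forall>i<n. \<forall>j<n.
      quad_mat n (F $ k) $$ (i, j) = W2 $$ (k, 0) * W1 $$ (0, i) * W1 $$ (0, j)"
    using quad_mat_param_map by blast
  then show "\<exists>a b. \<forall>k<m. \<forall>i<n. \<forall>j<n. quad_mat n (F $ k) $$ (i, j) = b k * a i * a j"
    by (intro exI[of _ "\<lambda>i. W1 $$ (0, i)"] exI[of _ "\<lambda>k. W2 $$ (k, 0)"])
next
  fix a b
  assume F: "F \<in> Sym_tuples n 2 m"
    "\<forall>k<m. \<forall>i<n. \<forall>j<n. quad_mat n (F $ k) $$ (i, j) = b k * a i * a j"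
  \<comment> \<open>The network built from \<open>a\<close> and \<open>b\<close> has the same
    matrices as \<open>F\<close>, and \<open>quad_mat\<close> is injective on quadratic
    forms.\<close>
  obtain G where G: "G \<in> neuromanifold [n, 1, m] 2"
    "\<And>k i j. k < m \<Longrightarrow> i < n \<Longrightarrow> j < n \<Longrightarrow> quad_mat n (G $ k) $$ (i, j) = b k * a i * a j"
    using neuromanifold_exists[of n m b a] by blast
  moreover have "G \<in> Sym_tuples n 2 m"
    using G(1) neuromanifold_Sym_tuples by blast
  ultimately have "F = G"
    using F by (intro eq_vecI quad_mat_eqI[of _ n]) (auto simp: Sym_tuples_def)
  with G(1) show "F \<in> neuromanifold [n, 1, m] 2" by simp
qed

text \<open>A nonzero entry of one symmetric rank-one matrix forces a nonzero diagonal entry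
  \<open>G l i i\<close>, and then the \<open>i\<close>-th row of \<open>G l\<close> serves as the common vector.\<close>

lemma common_rank_one_factor:
  fixes G :: "nat \<Rightarrow> nat \<Rightarrow> nat \<Rightarrow> real"
  assumes sym: "\<And>k i j. k < m \<Longrightarrow> i < n \<Longrightarrow> j < n \<Longrightarrow> G k i j = G k j i"
    and swap: "\<And>k l i i' j j'. k < m \<Longrightarrow> l < m \<Longrightarrow> i < n \<Longrightarrow> i' < n \<Longrightarrow> j < n \<Longrightarrow> j' < n \<Longrightarrow>
      G k i j * G l i' j' = G l i j' * G k i' j"
  shows "\<exists>a b. \<forall>k<m. \<forall>i<n. \<forall>j<n. G k i j = b k * a i * a j"
proof (cases "\<forall>k<m. \<forall>i<n. \<forall>j<n. G k i j = 0")
  case True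
  then show ?thesis by (intro exI[of _ "\<lambda>_. 0"]) auto
next
  case False
  then obtain l i j where lij: "l < m" "i < n" "j < n" "G l i j \<noteq> 0" by blast
  then have "G l i i \<noteq> 0"
    using swap[of l l i j j i] sym[of l i j] by auto
  moreover have "G k p q * G l i i * G l i i = G k i i * G l p i * G l q i"
    if "k < m" "p < n" "q < n" for k p q
  proof -
    have "G k p q * G l i i = G l p i * G k i q"
      using swap[of k l p i q i] that lij by simp
    moreover have "G k i q * G l i i = G k i i * G l q i"
      using swap[of k l q i i i] sym[of k i q] that lij by simp
    ultimately show ?thesis by (simp add: mult.commute mult.left_commute)
  qed
  ultimately have "\<forall>k<m. \<forall>p<n. \<forall>q<n. G k p q = G k i i / (G l i i)\<^sup>2 * G l p i * G l q i"
    by (simp add: field_simps power2_eq_square)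
  then show ?thesis
    by (intro exI[of _ "\<lambda>p. G l p i"] exI[of _ "\<lambda>k. G k i i / (G l i i)\<^sup>2"])
qed

text \<open>Both inclusions pass through the entry formula \<open>b k * a i * a j\<close>. Being
  multiples of each other is demanded only among the matrices of rank one, so zero matrices need
  separate treatment in both directions.\<close>

lemma image_quad_mat_neuromanifold:
  "map_vec (quad_mat n) ` neuromanifold [n, 1, m] 2 =
    {A \<in> carrier_vec m.
      (\<forall>k<m. A $ k \<in> carrier_mat n n \<and> transpose_mat (A $ k) = A $ k \<and> mat_rank (A $ k) \<le> 1) \<and>
      (\<forall>k<m. \<forall>l<m. mat_rank (A $ k) = 1 \<and> mat_rank (A $ l) = 1 \<longrightarrow>
        (\<exists>c. A $ k = c \<cdot>\<^sub>m A $ l))}" (is "_ = ?R")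
proof (intro equalityI subsetI)
  fix A assume "A \<in> map_vec (quad_mat n) ` neuromanifold [n, 1, m] 2"
  then obtain F a b where F: "F \<in> Sym_tuples n 2 m" and A: "A = map_vec (quad_mat n) F"
    and ab: "\<And>k i j. k < m \<Longrightarrow> i < n \<Longrightarrow> j < n \<Longrightarrow> quad_mat n (F $ k) $$ (i, j) = b k * a i * a j"
    unfolding neuromanifold_iff image_iff Bex_def by metis
  have Fk: "A $ k = quad_mat n (F $ k)" "F $ k \<in> Sym n 2" if "k < m" for k
    using F that A by (auto simp: Sym_tuples_def)
  have sym: "A $ k \<in> carrier_mat n n" "transpose_mat (A $ k) = A $ k" if "k < m" for k
    using Fk[OF that] quad_mat_bij[of n] by (auto simp: bij_betw_def)
  have ent: "A $ k $$ (i, j) = b k * a i * a j" if "k < m" "i < n" "j < n" for k i j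
    using ab Fk that by simp
  have "mat_rank (A $ k) \<le> 1" if "k < m" for k
    using sym[OF that] ent[OF that]
    by (intro vec_space.rank_le_1_product_entries[of _ _ n "\<lambda>i. b k * a i" a]) auto
  \<comment> \<open>Rank one of \<open>A $ l\<close> forces \<open>b l\<close> to be nonzero, so
    even a zero matrix \<open>A $ k\<close> is a multiple of it.\<close>
  moreover have "\<exists>c. A $ k = c \<cdot>\<^sub>m A $ l"
    if "k < m" "l < m" "mat_rank (A $ l) = 1" for k l
  proof -
    have "b l \<noteq> 0"
    proof
      assume "b l = 0"
      then have "A $ l = 0\<^sub>m n n"
        using sym[OF \<open>l < m\<close>] ent[OF \<open>l < m\<close>] by (intro eq_matI) auto
      with that(3) show False
        by (simp add: vec_space.rank_0I)
    qed
    then have "A $ k = (b k / b l) \<cdot>\<^sub>m A $ l"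
      using sym[OF \<open>l < m\<close>] sym[OF \<open>k < m\<close>] ent that by (intro eq_matI) auto
    then show ?thesis ..
  qed
  moreover have "A \<in> carrier_vec m"
    using F A by (auto simp: Sym_tuples_def)
  ultimately show "A \<in> ?R"
    using sym by blast
next
  fix A assume "A \<in> ?R"
  then have A: "A \<in> carrier_vec m"
    and sym: "\<And>k. k < m \<Longrightarrow> A $ k \<in> carrier_mat n n" "\<And>k. k < m \<Longrightarrow> transpose_mat (A $ k) = A $ k"
    and rank: "\<And>k. k < m \<Longrightarrow> mat_rank (A $ k) \<le> 1"
    and multiple: "\<And>k l. k < m \<Longrightarrow> l < m \<Longrightarrow> mat_rank (A $ k) = 1 \<Longrightarrow> mat_rank (A $ l) = 1 \<Longrightarrow>
      \<exists>c. A $ k = c \<cdot>\<^sub>m A $ l"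
    by blast+
  have dims [simp]: "dim_row (A $ k) = n" "dim_col (A $ k) = n" if "k < m" for k
    using sym(1)[OF that] by auto
  have dich: "mat_rank (A $ k) = 1 \<or> (\<forall>i<n. \<forall>j<n. A $ k $$ (i, j) = 0)" if "k < m" for k
    using rank[OF that] mat_rank_eq_0D[of "A $ k"] that by (cases "mat_rank (A $ k) = 0") auto
  \<comment> \<open>For two proportional matrices this is \<open>c\<close> times a vanishing minor
    of \<open>A $ l\<close>; otherwise one of the two matrices is zero and both sides
    vanish.\<close>
  have swap: "A $ k $$ (i, j) * A $ l $$ (i', j') = A $ l $$ (i, j') * A $ k $$ (i', j)"
    if "k < m" "l < m" "i < n" "i' < n" "j < n" "j' < n" for k l i i' j j'
  proof (cases "mat_rank (A $ k) = 1 \<and> mat_rank (A $ l) = 1")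
    case True
    with multiple that obtain c where "A $ k = c \<cdot>\<^sub>m A $ l" by blast
    then show ?thesis
      using that mat_rank_le_1D[OF rank[of l], of i i' j j'] by simp
  next
    case False
    then show ?thesis using dich[OF that(1)] dich[OF that(2)] that by auto
  qed
  have entry_sym: "A $ k $$ (i, j) = A $ k $$ (j, i)" if "k < m" "i < n" "j < n" for k i j
    using arg_cong[OF sym(2)[OF that(1)], of "\<lambda>B. B $$ (j, i)"] that by simp
  have "\<exists>a b. \<forall>k<m. \<forall>i<n. \<forall>j<n. A $ k $$ (i, j) = b k * a i * a j"
    by (rule common_rank_one_factor; rule entry_sym swap; assumption)
  then obtain a b
    where ab: "\<And>k i j. k < m \<Longrightarrow> i < n \<Longrightarrow> j < n \<Longrightarrow> A $ k $$ (i, j) = b k * a i * a j"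
    by blast
  obtain F where F: "F \<in> neuromanifold [n, 1, m] 2"
    "\<And>k i j. k < m \<Longrightarrow> i < n \<Longrightarrow> j < n \<Longrightarrow> quad_mat n (F $ k) $$ (i, j) = b k * a i * a j"
    using neuromanifold_exists[of n m b a] by blast
  have "F \<in> carrier_vec m"
    using F(1) neuromanifold_Sym_tuples by (auto simp: Sym_tuples_def)
  then have "A = map_vec (quad_mat n) F"
  proof (intro eq_vecI)
    fix k assume "k < dim_vec (map_vec (quad_mat n) F)"
    with \<open>F \<in> carrier_vec m\<close> have "k < m" by simp
    then have "A $ k = quad_mat n (F $ k)"
      using F(2) ab by (intro eq_matI) (auto simp: quad_mat_def)
    with \<open>k < m\<close> \<open>F \<in> carrier_vec m\<close> show "A $ k = map_vec (quad_mat n) F $ k" by simp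
  qed (use A in auto)
  with F(1) show "A \<in> map_vec (quad_mat n) ` neuromanifold [n, 1, m] 2" by blast
qed


section \<open>Monomials in the matrix entries\<close>

text \<open>The index pairs are ordered, so each off-diagonal entry has two names, (k, i, j) and (k,
  j, i). Passing between them lets either index be exchanged.\<close>

definition triples :: "nat \<Rightarrow> nat \<Rightarrow> (nat \<times> nat \<times> nat) set" where
  "triples n m = {..<m} \<times> {..<n} \<times> {..<n}"

definition entry :: "nat \<Rightarrow> nat \<times> nat \<times> nat \<Rightarrow> coord rpoly" where
  "entry n = (\<lambda>(k, i, j). generic_quad_mat n k $$ (i, j))"

definition entry_prod :: "nat \<Rightarrow> (nat \<times> nat \<times> nat) multiset \<Rightarrow> coord rpoly" where
  "entry_prod n M = \<Prod>\<^sub># (image_mset (entry n) M)"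

definition indices :: "(nat \<times> nat \<times> nat) multiset \<Rightarrow> nat multiset" where
  "indices M = (\<Sum>(k, i, j)\<in>#M. {#i, j#})"

lemma entry_prod_simps [simp]:
  "entry_prod n {#} = 1"
  "entry_prod n (add_mset t M) = entry n t * entry_prod n M"
  "entry_prod n (M + N) = entry_prod n M * entry_prod n N"
  by (simp_all add: entry_prod_def)

lemma indices_simps [simp]:
  "indices {#} = {#}"
  "indices (add_mset (k, i, j) M) = add_mset i (add_mset j (indices M))"
  by (simp_all add: indices_def)

lemma in_indicesE:
  assumes "x \<in># indices M"
  obtains k i j where "(k, i, j) \<in># M" "x = i \<or> x = j"
  using assms by (auto simp: indices_def)

lemma entry_commute: "i < n \<Longrightarrow> j < n \<Longrightarrow> entry n (k, i, j) = entry n (k, j, i)"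
  by (simp add: entry_def generic_quad_mat_def quad_monomial_commute)

text \<open>Block \<open>k\<close> occupies the columns from \<open>k * n\<close> up to, but
  excluding, \<open>Suc k * n\<close>.\<close>

lemma generic_flattening_entry:
  assumes "i < n" "j < n" "k < m"
  shows "k * n + j < n * m" "generic_flattening n m $$ (i, k * n + j) = entry n (k, i, j)"
proof -
  have "k * n + j < Suc k * n" using assms by simp
  also have "\<dots> \<le> m * n" using assms by (intro mult_le_mono1) simp
  finally show "k * n + j < n * m" by (simp add: mult.commute)
  then show "generic_flattening n m $$ (i, k * n + j) = entry n (k, i, j)"
    using assms by (simp add: generic_flattening_def entry_def)
qed

text \<open>The basic exchange relation: the minor with rows \<open>i\<close>, \<open>i'\<close> and
  with column \<open>j\<close> of block \<open>k\<close> and column \<open>j'\<close> of block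
  \<open>l\<close> trades the first indices of two factors. The blocks may coincide.\<close>

lemma minors_generic_flattening_subsetD:
  assumes "minors 2 (generic_flattening n m) \<subseteq> J" "0 \<in> J" "\<And>x. x \<in> J \<Longrightarrow> - x \<in> J"
    and "k < m" "l < m" "i < n" "i' < n" "j < n" "j' < n"
  shows "entry n (k, i, j) * entry n (l, i', j') - entry n (k, i', j) * entry n (l, i, j') \<in> J"
proof -
  have "dim_row (generic_flattening n m) = n" "dim_col (generic_flattening n m) = n * m"
    by (simp_all add: generic_flattening_def)
  then show ?thesis
    using minors_2_subsetD[OF assms(1-3), of i i' "k * n + j" "l * n + j'"] assms(4-)
      generic_flattening_entry[of _ n _ _ m]
    by (simp add: mult.commute)
qed

section \<open>Evaluation of entries and membership in the coordinate ring\<close>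

lemma eval_entry:
  assumes "i < n" "j < n"
  shows "eval (coeffs F) (entry n (k, i, j)) = quad_mat n (F $ k) $$ (i, j)"
  using assms
  by (simp add: entry_def generic_quad_mat_def quad_mat_def coeffs_def eval_mult eval_Const eval_Var)

lemma eval_uminus: "eval x (- p) = - eval x p"
  using eval_add[of x p "- p"] by (simp add: eval_zero)

lemma eval_diff: "eval x (p - q) = eval x p - eval x q"
  using eval_add[of x p "- q"] by (simp add: eval_uminus)

lemma coord_ring_simps:
  "a \<oplus>\<^bsub>coord_ring n D m\<^esub> b = a + b" "a \<otimes>\<^bsub>coord_ring n D m\<^esub> b = a * b"
  "\<zero>\<^bsub>coord_ring n D m\<^esub> = 0" "\<one>\<^bsub>coord_ring n D m\<^esub> = 1"
  by (simp_all add: coord_ring_def)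

lemma Const_in_coord_ring: "Const c \<in> carrier (coord_ring n D m)"
  by (auto simp: coord_ring_def Const_def)

lemma Var_in_coord_ring: "v \<in> coords n D m \<Longrightarrow> Var v \<in> carrier (coord_ring n D m)"
  by (auto simp: coord_ring_def Var_def)

lemma coord_ring_closed:
  assumes "a \<in> carrier (coord_ring n D m)" "b \<in> carrier (coord_ring n D m)"
  shows "a + b \<in> carrier (coord_ring n D m)" "a * b \<in> carrier (coord_ring n D m)"
proof -
  interpret cring "coord_ring n D m" by (rule cring_coord_ring)
  show "a + b \<in> carrier (coord_ring n D m)" "a * b \<in> carrier (coord_ring n D m)"
    using a_closed[OF assms] m_closed[OF assms] by (simp_all add: coord_ring_simps)
qed

lemma uminus_in_coord_ring: "a \<in> carrier (coord_ring n D m) \<Longrightarrow> - a \<in> carrier (coord_ring n D m)"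
  by (auto simp: coord_ring_def in_keys_iff)

lemma entry_in_coord_ring:
  assumes "t \<in> triples n m"
  shows "entry n t \<in> carrier (coord_ring n 2 m)"
proof -
  have "(k, quad_monomial i j) \<in> coords n 2 m" if "k < m" "i < n" "j < n" for k i j
    using that by (auto simp: coords_def monomials_2)
  then show ?thesis
    using assms
    by (auto simp: entry_def generic_quad_mat_def triples_def
        intro!: Var_in_coord_ring coord_ring_closed Const_in_coord_ring)
qed

lemma entry_prod_in_coord_ring:
  assumes "set_mset M \<subseteq> triples n m"
  shows "entry_prod n M \<in> carrier (coord_ring n 2 m)"
  using assms
proof (induction M)
  case empty
  show ?case using Const_in_coord_ring[of 1] by simp
qed (auto intro: coord_ring_closed entry_in_coord_ring)

lemma minors_in_coord_ring: "minors 2 (generic_flattening n m) \<subseteq> carrier (coord_ring n 2 m)"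
proof -
  have ent: "generic_flattening n m $$ (i, l) \<in> carrier (coord_ring n 2 m)"
    if "i < n" "l < n * m" for i l
  proof -
    have "n > 0" using that by simp
    then have "l mod n < n" "l div n < m" using that(2)
      by (simp_all add: div_less_iff_less_mult mult.commute)
    with that entry_in_coord_ring[of "(l div n, i, l mod n)" n m] show ?thesis
      by (simp add: triples_def generic_flattening_def entry_def)
  qed
  have dims: "dim_row (generic_flattening n m) = n" "dim_col (generic_flattening n m) = n * m"
    by (simp_all add: generic_flattening_def)
  show ?thesis
    unfolding minors_2 dims
  proof (clarify, unfold diff_conv_add_uminus)
    fix i i' l l' assume "i < i'" "i' < n" "l < l'" "l' < n * m"
    then show "generic_flattening n m $$ (i, l) * generic_flattening n m $$ (i', l') +
        - (generic_flattening n m $$ (i, l') * generic_flattening n m $$ (i', l))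
        \<in> carrier (coord_ring n 2 m)"
      by (intro coord_ring_closed uminus_in_coord_ring ent) auto
  qed
qed

section \<open>Ideals of the coordinate ring expressed with the ordinary ring operations\<close>

context
  fixes n D m :: nat and J :: "coord rpoly set"
  assumes ideal: "ideal J (coord_ring n D m)"
begin

lemma coord_ideal_0: "0 \<in> J"
  using additive_subgroup.zero_closed[OF ideal.axioms(1)[OF ideal]] by (simp add: coord_ring_simps)

lemma coord_ideal_add: "a \<in> J \<Longrightarrow> b \<in> J \<Longrightarrow> a + b \<in> J"
  using additive_subgroup.a_closed[OF ideal.axioms(1)[OF ideal]] by (simp add: coord_ring_simps)

lemma coord_ideal_mult: "a \<in> J \<Longrightarrow> c \<in> carrier (coord_ring n D m) \<Longrightarrow> c * a \<in> J"
  using ideal.I_l_closed[OF ideal] by (simp add: coord_ring_simps)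

lemma coord_ideal_uminus:
  assumes "a \<in> J"
  shows "- a \<in> J"
proof -
  have "Const (- 1) * a = - a"
    by (simp add: Const_def single_uminus)
  with coord_ideal_mult[OF assms Const_in_coord_ring[of "- 1"]] show ?thesis by simp
qed

lemma coord_ideal_sum: "(\<And>x. x \<in> A \<Longrightarrow> f x \<in> J) \<Longrightarrow> sum f A \<in> J"
  by (induction A rule: infinite_finite_induct) (auto simp: coord_ideal_0 coord_ideal_add)

lemma coord_ideal_diff_trans: "a - b \<in> J \<Longrightarrow> b - c \<in> J \<Longrightarrow> a - c \<in> J"
  using coord_ideal_add[of "a - b" "b - c"] by simp

end

section \<open>Exchange of indices modulo the minors\<close>

context
  fixes n m :: nat and J :: "coord rpoly set"
  assumes ideal: "ideal J (coord_ring n 2 m)"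
    and minors: "minors 2 (generic_flattening n m) \<subseteq> J"
begin

text \<open>Any index \<open>x\<close> present can be brought into the first slot of a distinguished
  factor (k, p, j): the factor of \<open>M\<close> containing \<open>x\<close> receives
  \<open>p\<close> in return. Matrix numbers and the total index multiset are preserved.\<close>

lemma exchange_index:
  assumes M: "set_mset M \<subseteq> triples n m" and x: "x \<in># add_mset p (indices M)"
    and bounds: "k < m" "p < n" "j < n"
  obtains N where "set_mset N \<subseteq> triples n m" "image_mset fst N = image_mset fst M"
    "add_mset x (indices N) = add_mset p (indices M)"
    "entry n (k, p, j) * entry_prod n M - entry n (k, x, j) * entry_prod n N \<in> J"
proof (cases "x = p")
  case True
  then show ?thesis using that[of M] M coord_ideal_0[OF ideal] by simp
next
  case False
  with x obtain l i i' where t: "(l, i, i') \<in># M" "x = i \<or> x = i'"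
    by (auto elim: in_indicesE)
  \<comment> \<open>\<open>y\<close> is the partner of \<open>x\<close> in its factor; by symmetry
    of the matrices that factor may be read as (l, x, y), with \<open>x\<close> in the slot the
    minor can move.\<close>
  define y where "y = (if x = i then i' else i)"
  define M' where "M' = M - {#(l, i, i')#}"
  from t(1) have M_eq: "M = add_mset (l, i, i') M'" by (simp add: M'_def)
  with M have tri: "l < m" "i < n" "i' < n" "set_mset M' \<subseteq> triples n m"
    by (auto simp: triples_def)
  have ent: "entry n (l, i, i') = entry n (l, x, y)"
    using t(2) tri entry_commute[of i n i' l] by (auto simp: y_def)
  have xy: "x < n" "y < n" "{#i, i'#} = {#x, y#}"
    using t(2) tri by (auto simp: y_def)
  \<comment> \<open>The minor with rows \<open>p\<close>, \<open>x\<close>, multiplied by the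
    untouched factors.\<close>
  have "entry_prod n M' * (entry n (k, p, j) * entry n (l, x, y) -
      entry n (k, x, j) * entry n (l, p, y)) \<in> J"
    using minors_generic_flattening_subsetD[OF minors coord_ideal_0[OF ideal] coord_ideal_uminus[OF ideal]]
      tri xy bounds
    by (intro coord_ideal_mult[OF ideal] entry_prod_in_coord_ring) auto
  then have "entry n (k, p, j) * entry_prod n M -
      entry n (k, x, j) * entry_prod n (add_mset (l, p, y) M') \<in> J"
    by (simp add: M_eq ent algebra_simps)
  then show ?thesis
    using tri xy bounds
    by (intro that[of "add_mset (l, p, y) M'"]) (auto simp: M_eq triples_def add_mset_commute)
qed

text \<open>Induction on \<open>M\<close>: a factor of \<open>N\<close> with the matrix number of
  \<open>t\<close> is turned into \<open>t\<close> by at most two nontrivial exchanges. What is left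
  of \<open>N\<close> then has the same invariants as \<open>M\<close>, so the induction hypothesis
  applies.\<close>

lemma entry_prod_cong:
  assumes "set_mset M \<subseteq> triples n m" "set_mset N \<subseteq> triples n m"
    "image_mset fst M = image_mset fst N" "indices M = indices N"
  shows "entry_prod n M - entry_prod n N \<in> J"
  using assms
proof (induction M arbitrary: N)
  case empty
  then show ?case using coord_ideal_0[OF ideal] by simp
next
  case (add t M N)
  obtain k i j where t: "t = (k, i, j)" by (cases t)
  with add.prems have bounds: "k < m" "i < n" "j < n" "set_mset M \<subseteq> triples n m"
    by (auto simp: triples_def)
  have "k \<in># image_mset fst N"
    using add.prems(3) t by (metis fst_conv image_mset_add_mset union_single_eq_member)
  then obtain p q where "(k, p, q) \<in># N" by auto
  then obtain N1 where N: "N = add_mset (k, p, q) N1" by (metis insert_DiffM)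
  with add.prems have N1: "p < n" "q < n" "set_mset N1 \<subseteq> triples n m"
    "image_mset fst N1 = image_mset fst M"
    by (auto simp: triples_def t)
  have ind: "add_mset p (add_mset q (indices N1)) = add_mset i (add_mset j (indices M))"
    using add.prems(4) by (simp add: N t)
  \<comment> \<open>The first exchange secures \<open>i\<close> and parks it in the second slot,
    because exchanges act on the first one; \<open>q'\<close> is the index still to be replaced by
    \<open>j\<close>. If \<open>i = q\<close>, it is already parked and
    \<open>q' = p\<close>.\<close>
  obtain q' N2 where N2: "q' < n" "set_mset N2 \<subseteq> triples n m" "image_mset fst N2 = image_mset fst M"
    "add_mset q' (indices N2) = add_mset j (indices M)"
    "entry_prod n N - entry n (k, q', i) * entry_prod n N2 \<in> J"
  proof (cases "i = q")
    case True
    then show ?thesis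
      using that[of p N1] N1 ind coord_ideal_0[OF ideal] by (simp add: N add_mset_commute)
  next
    case False
    then have "i \<in># add_mset p (indices N1)"
      by (metis ind insert_noteq_member add_mset_commute union_single_eq_member)
    from exchange_index[OF N1(3) this bounds(1) N1(1,2)] obtain N2
      where "set_mset N2 \<subseteq> triples n m" "image_mset fst N2 = image_mset fst N1"
        "add_mset i (indices N2) = add_mset p (indices N1)"
        "entry n (k, p, q) * entry_prod n N1 - entry n (k, i, q) * entry_prod n N2 \<in> J" .
    moreover from this(3) have "add_mset i (add_mset q (indices N2)) = add_mset i (add_mset j (indices M))"
      using ind by (metis add_mset_commute)
    ultimately show ?thesis
      using that[of q N2] N1 bounds entry_commute[of i n q k] by (simp add: N)
  qed
  \<comment> \<open>The second exchange replaces \<open>q'\<close> by \<open>j\<close>; the factor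
    becomes (k, j, i), which is the entry of \<open>t\<close> by symmetry. Cancelling
    \<open>j\<close> shows that \<open>N3\<close> and \<open>M\<close> have equal index
    multisets.\<close>
  have "j \<in># add_mset q' (indices N2)" by (simp add: N2(4))
  from exchange_index[OF N2(2) this bounds(1) N2(1) bounds(2)] obtain N3
    where N3: "set_mset N3 \<subseteq> triples n m" "image_mset fst N3 = image_mset fst N2"
      "add_mset j (indices N3) = add_mset q' (indices N2)"
      "entry n (k, q', i) * entry_prod n N2 - entry n (k, j, i) * entry_prod n N3 \<in> J" .
  have "entry_prod n M - entry_prod n N3 \<in> J"
    using add.IH[of N3] bounds N2 N3 by simp
  then have "entry n t * (entry_prod n M - entry_prod n N3) \<in> J"
    using add.prems(1) by (intro coord_ideal_mult[OF ideal] entry_in_coord_ring) auto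
  then have "entry_prod n (add_mset t M) - entry n (k, j, i) * entry_prod n N3 \<in> J"
    using entry_commute[OF bounds(2,3)] by (simp add: t algebra_simps)
  moreover have "entry_prod n N - entry n (k, j, i) * entry_prod n N3 \<in> J"
    by (rule coord_ideal_diff_trans[OF ideal N2(5) N3(4)])
  ultimately show ?case
    using coord_ideal_diff_trans[OF ideal] coord_ideal_uminus[OF ideal] by (metis minus_diff_eq)
qed

end

text \<open>A coordinate equals an entry on the diagonal and twice an entry off it. Scalar multiples
  of entry products contain 1 and are closed under multiplication, so they contain every monomial;
  \<open>c\<close> collects the factors 2.\<close>

lemma single_as_entry_prod:
  assumes "Poly_Mapping.keys \<mu> \<subseteq> coords n 2 m"
  shows "\<exists>c M. set_mset M \<subseteq> triples n m \<and> Poly_Mapping.single \<mu> 1 = Const c * entry_prod n M"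
proof -
  define S where "S = {P. \<exists>c M. set_mset M \<subseteq> triples n m \<and> P = Const c * entry_prod n M}"
  have mult: "P * Q \<in> S" if "P \<in> S" "Q \<in> S" for P Q
  proof -
    from that obtain c M d N where *: "set_mset M \<subseteq> triples n m" "P = Const c * entry_prod n M"
      "set_mset N \<subseteq> triples n m" "Q = Const d * entry_prod n N"
      by (auto simp: S_def)
    then have "P * Q = Const (c * d) * entry_prod n (M + N)"
      by (simp add: Const_mult mult_ac)
    moreover have "set_mset (M + N) \<subseteq> triples n m" using * by auto
    ultimately show ?thesis unfolding S_def by blast
  qed
  have one: "1 \<in> S"
    unfolding S_def by (intro CollectI exI[of _ 1] exI[of _ "{#}"]) simp
  have Var: "Var v \<in> S" if "v \<in> coords n 2 m" for v
  proof -
    from that obtain k i j where v: "v = (k, quad_monomial i j)" and kij: "k < m" "i < n" "j < n"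
      by (auto simp: coords_def monomials_2)
    have "Var v = Const (if i = j then 1 else 2) * entry_prod n {#(k, i, j)#}"
      using kij by (simp add: v entry_def generic_quad_mat_def mult.assoc[symmetric] flip: Const_mult)
    moreover have "set_mset {#(k, i, j)#} \<subseteq> triples n m"
      using kij by (simp add: triples_def)
    ultimately show ?thesis unfolding S_def by blast
  qed
  have "Poly_Mapping.single (Poly_Mapping.single v e) 1 \<in> S" if "v \<in> coords n 2 m" for v e
  proof (induction e)
    case (Suc e)
    have "Poly_Mapping.single (Poly_Mapping.single v (Suc e)) 1 =
        Var v * Poly_Mapping.single (Poly_Mapping.single v e) (1 :: real)"
      by (simp add: Var_def mult_single flip: single_add)
    then show ?case using mult[OF Var[OF that] Suc] by simp
  qed (use one in simp)
  with assms have "Poly_Mapping.single \<mu> 1 \<in> S"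
  proof (induction \<mu> rule: update_induct)
    case const
    show ?case using one by simp
  next
    case (update f v e)
    \<comment> \<open>The variable \<open>v\<close> does not occur in \<open>f\<close>, so updating
      is adding exponent vectors.\<close>
    have "Poly_Mapping.update v e f = f + Poly_Mapping.single v e"
      using update(1) by (intro poly_mapping_eqI)
        (auto simp: lookup_update lookup_add lookup_single when_def in_keys_iff)
    then have "Poly_Mapping.single (Poly_Mapping.update v e f) 1 =
        Poly_Mapping.single f 1 * Poly_Mapping.single (Poly_Mapping.single v e) (1 :: real)"
      by (simp add: mult_single)
    moreover have "Poly_Mapping.keys (Poly_Mapping.update v e f) = insert v (Poly_Mapping.keys f)"
      using update(2) by (auto simp: in_keys_iff lookup_update split: if_splits)
    with update(4) have "Poly_Mapping.keys f \<subseteq> coords n 2 m" "v \<in> coords n 2 m"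
      by simp_all
    ultimately show ?case using update mult by simp
  qed
  then show ?thesis unfolding S_def by blast
qed

lemma coord_ring_as_sum:
  assumes "P \<in> carrier (coord_ring n 2 m)"
  obtains c M where "\<And>\<mu>. \<mu> \<in> Poly_Mapping.keys P \<Longrightarrow> set_mset (M \<mu>) \<subseteq> triples n m"
    "P = (\<Sum>\<mu>\<in>Poly_Mapping.keys P. Const (c \<mu>) * entry_prod n (M \<mu>))"
proof -
  have "\<forall>\<mu>\<in>Poly_Mapping.keys P. \<exists>c M. set_mset M \<subseteq> triples n m \<and>
      Poly_Mapping.single \<mu> 1 = Const c * entry_prod n M"
    using assms single_as_entry_prod by (auto simp: coord_ring_def)
  then obtain c M where cM: "\<And>\<mu>. \<mu> \<in> Poly_Mapping.keys P \<Longrightarrow> set_mset (M \<mu>) \<subseteq> triples n m \<and>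
      Poly_Mapping.single \<mu> 1 = Const (c \<mu>) * entry_prod n (M \<mu>)"
    by metis
  have "P = (\<Sum>\<mu>\<in>Poly_Mapping.keys P. Const (Poly_Mapping.lookup P \<mu>) * Poly_Mapping.single \<mu> 1)"
    unfolding Const_mult_single mult_1_right by (rule rpoly_as_sum)
  also have "\<dots> = (\<Sum>\<mu>\<in>Poly_Mapping.keys P.
      Const (Poly_Mapping.lookup P \<mu> * c \<mu>) * entry_prod n (M \<mu>))"
    using cM by (intro sum.cong refl) (simp only: Const_mult mult.assoc)
  finally show ?thesis
    using cM by (intro that[of M "\<lambda>\<mu>. Poly_Mapping.lookup P \<mu> * c \<mu>"]) auto
qed


section \<open>The vanishing ideal\<close>

text \<open>Dedekind's independence of characters, in induction form. Two distinct characters differ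
  at some \<open>y\<close>; translating the relation by \<open>y\<close> and subtracting a multiple
  of the original eliminates one of them.\<close>

lemma independent_characters:
  fixes G :: "('x \<Rightarrow> 'f::idom) set"
  assumes "finite G" "\<And>g. g \<in> G \<Longrightarrow> g e = 1" "\<And>g x y. g \<in> G \<Longrightarrow> g (mul x y) = g x * g y"
    and "\<And>x. (\<Sum>g\<in>G. c g * g x) = 0" "g \<in> G"
  shows "c g = 0"
  using assms
proof (induction G arbitrary: c g rule: finite_induct)
  case (insert h G)
  have rest: "c g = 0" if "g \<in> G" for g
  proof -
    from insert.hyps that have "g \<noteq> h" by blast
    then obtain y where y: "g y \<noteq> h y" by blast
    \<comment> \<open>This is the relation at \<open>mul x y\<close> minus \<open>h y\<close> times
      the relation at \<open>x\<close>; the term of \<open>h\<close> cancels, leaving a relation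
      among the characters in \<open>G\<close>.\<close>
    have "(\<Sum>g\<in>G. (c g * (g y - h y)) * g x) = 0" for x
    proof -
      have "(\<Sum>g\<in>G. (c g * (g y - h y)) * g x) = (\<Sum>g\<in>insert h G. (c g * (g y - h y)) * g x)"
        using insert.hyps by simp
      also have "\<dots> = (\<Sum>g\<in>insert h G. c g * g (mul x y)) - h y * (\<Sum>g\<in>insert h G. c g * g x)"
        unfolding sum_distrib_left sum_subtractf[symmetric]
      proof (intro sum.cong refl)
        fix f assume "f \<in> insert h G"
        then have "f (mul x y) = f x * f y" by (rule insert.prems(2))
        then show "c f * (f y - h y) * f x = c f * f (mul x y) - h y * (c f * f x)"
          by (simp add: algebra_simps)
      qed
      finally show ?thesis unfolding insert.prems(3) by simp
    qed
    from insert.IH[OF _ _ this that] insert.prems(1,2) have "c g * (g y - h y) = 0" by blast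
    with y show ?thesis by simp
  qed
  \<comment> \<open>Once all other coefficients vanish, evaluation at \<open>e\<close> isolates that
    of \<open>h\<close>.\<close>
  then have "(\<Sum>g\<in>insert h G. c g * g e) = c h"
    using insert.hyps insert.prems(1)[of h] by simp
  with insert.prems(3)[of e] rest insert.prems(4) show ?case by auto
qed simp

text \<open>The value of a product of entries at the tuple of matrices \<open>b k * a i * a j\<close>.\<close>

definition param_char :: "(nat \<times> nat \<times> nat) multiset \<Rightarrow> (nat \<Rightarrow> real) \<times> (nat \<Rightarrow> real) \<Rightarrow> real" where
  "param_char M = (\<lambda>(a, b). \<Prod>(k, i, j)\<in>#M. b k * a i * a j)"

text \<open>Makes parameter monomials characters for the componentwise product of parameter pairs,
  with the all-ones pair as unit.\<close>

lemma param_char_mult: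
  "param_char M ((\<lambda>i. fst x i * fst y i), (\<lambda>k. snd x k * snd y k)) = param_char M x * param_char M y"
  by (induction M) (auto simp: param_char_def case_prod_beta mult_ac)

lemma param_char_one: "param_char M ((\<lambda>_. 1), (\<lambda>_. 1)) = 1"
  by (induction M) (auto simp: param_char_def)

text \<open>Setting one parameter to 2 and all others to 1 turns the monomial into 2 to the exponent
  of that parameter. The \<open>b\<close> parameters recover the matrix numbers and the
  \<open>a\<close> parameters the indices, a diagonal entry counting its index twice.\<close>

lemma param_char_inj:
  assumes "param_char M = param_char N"
  shows "image_mset fst M = image_mset fst N" "indices M = indices N"
proof -
  have "param_char M ((\<lambda>_. 1), (\<lambda>k. if k = k0 then 2 else 1)) = 2 ^ count (image_mset fst M) k0" for M k0
    by (induction M) (auto simp: param_char_def)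
  with assms have "(2::real) ^ count (image_mset fst M) k = 2 ^ count (image_mset fst N) k" for k
    by metis
  then show "image_mset fst M = image_mset fst N"
    by (intro multiset_eqI) simp
  have "param_char M ((\<lambda>i. if i = i0 then 2 else 1), (\<lambda>_. 1)) = 2 ^ count (indices M) i0" for M i0
    by (induction M) (auto simp: param_char_def)
  with assms have "(2::real) ^ count (indices M) i = 2 ^ count (indices N) i" for i
    by metis
  then show "indices M = indices N"
    by (intro multiset_eqI) simp
qed

lemma eval_entry_prod:
  assumes "set_mset M \<subseteq> triples n m"
    "\<And>k i j. k < m \<Longrightarrow> i < n \<Longrightarrow> j < n \<Longrightarrow> quad_mat n (F $ k) $$ (i, j) = b k * a i * a j"
  shows "eval (coeffs F) (entry_prod n M) = param_char M (a, b)"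
  using assms(1)
proof (induction M)
  case empty
  show ?case using eval_Const[of "coeffs F" 1] by (simp add: param_char_def)
next
  case (add t M)
  then show ?case
    by (cases t) (auto simp: param_char_def triples_def eval_mult eval_entry assms(2))
qed

text \<open>The terms of \<open>P\<close> are grouped into fibres by the character of their entry
  product. In a fibre the coefficients sum to zero and the products agree modulo \<open>J\<close>,
  so each fibre contributes an element of \<open>J\<close>.\<close>

lemma vanishing_on_neuromanifold_in_ideal:
  assumes ideal: "ideal J (coord_ring n 2 m)"
    and minors: "minors 2 (generic_flattening n m) \<subseteq> J"
    and P: "P \<in> carrier (coord_ring n 2 m)"
    and zero: "\<And>F. F \<in> neuromanifold [n, 1, m] 2 \<Longrightarrow> eval (coeffs F) P = 0"
  shows "P \<in> J"
proof -
  obtain c M where M: "\<And>\<mu>. \<mu> \<in> Poly_Mapping.keys P \<Longrightarrow> set_mset (M \<mu>) \<subseteq> triples n m"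
    and P_eq: "P = (\<Sum>\<mu>\<in>Poly_Mapping.keys P. Const (c \<mu>) * entry_prod n (M \<mu>))"
    by (rule coord_ring_as_sum[OF P]) (rule that)
  define K where "K = Poly_Mapping.keys P"
  define \<chi> where "\<chi> = (\<lambda>\<mu>. param_char (M \<mu>))"
  define fibre where "fibre g = {\<mu> \<in> K. \<chi> \<mu> = g}" for g
  have [simp]: "finite K" by (simp add: K_def)
  \<comment> \<open>Every parameter pair is realised by a network, and \<open>P\<close> vanishes
    there.\<close>
  have zero_K: "(\<Sum>\<mu>\<in>K. c \<mu> * \<chi> \<mu> x) = 0" for x
  proof -
    obtain a b where x: "x = (a, b)" by (cases x)
    obtain F where F: "F \<in> neuromanifold [n, 1, m] 2"
      "\<And>k i j. k < m \<Longrightarrow> i < n \<Longrightarrow> j < n \<Longrightarrow> quad_mat n (F $ k) $$ (i, j) = b k * a i * a j"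
      using neuromanifold_exists[of n m b a] by blast
    have "eval (coeffs F) P = (\<Sum>\<mu>\<in>K. c \<mu> * eval (coeffs F) (entry_prod n (M \<mu>)))"
      by (subst P_eq) (simp add: eval_sum eval_mult eval_Const K_def)
    also have "\<dots> = (\<Sum>\<mu>\<in>K. c \<mu> * \<chi> \<mu> x)"
    proof (intro sum.cong refl)
      fix \<mu> assume "\<mu> \<in> K"
      then have "eval (coeffs F) (entry_prod n (M \<mu>)) = \<chi> \<mu> x"
        unfolding \<chi>_def x by (intro eval_entry_prod[OF M F(2)]) (simp_all add: K_def)
      then show "c \<mu> * eval (coeffs F) (entry_prod n (M \<mu>)) = c \<mu> * \<chi> \<mu> x" by simp
    qed
    finally show ?thesis using zero[OF F(1)] by simp
  qed
  have independence: "(\<Sum>g\<in>\<chi> ` K. sum c (fibre g) * g x) = 0" for x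
  proof -
    have "(\<Sum>\<mu>\<in>K. c \<mu> * \<chi> \<mu> x) = (\<Sum>g\<in>\<chi> ` K. \<Sum>\<mu>\<in>fibre g. c \<mu> * \<chi> \<mu> x)"
      unfolding fibre_def by (rule sum.image_gen) simp
    also have "\<dots> = (\<Sum>g\<in>\<chi> ` K. sum c (fibre g) * g x)"
      by (intro sum.cong) (auto simp: fibre_def sum_distrib_right)
    finally show ?thesis using zero_K by simp
  qed
  have fibre_sum: "sum c (fibre g) = 0" if "g \<in> \<chi> ` K" for g
  proof (rule independent_characters[OF _ _ _ independence that])
    show "g ((\<lambda>_. 1), (\<lambda>_. 1)) = 1" if "g \<in> \<chi> ` K" for g
      using that by (auto simp: \<chi>_def param_char_one)
    show "g ((\<lambda>i. fst x i * fst y i), (\<lambda>k. snd x k * snd y k)) = g x * g y" if "g \<in> \<chi> ` K" for g x y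
      using that unfolding \<chi>_def by (elim imageE) (simp only: param_char_mult)
  qed simp
  \<comment> \<open>The product of \<open>\<nu>\<close> represents the fibre. Since the coefficients
    sum to zero, it can be subtracted from every product without changing the sum, and each
    difference lies in \<open>J\<close>.\<close>
  have "(\<Sum>\<mu>\<in>fibre (\<chi> \<nu>). Const (c \<mu>) * entry_prod n (M \<mu>)) \<in> J" if \<nu>: "\<nu> \<in> K" for \<nu>
  proof -
    have "(\<Sum>\<mu>\<in>fibre (\<chi> \<nu>). Const (c \<mu>) * entry_prod n (M \<nu>)) =
        Const (sum c (fibre (\<chi> \<nu>))) * entry_prod n (M \<nu>)"
      by (simp add: Const_sum sum_distrib_right)
    then have "(\<Sum>\<mu>\<in>fibre (\<chi> \<nu>). Const (c \<mu>) * entry_prod n (M \<mu>)) =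
        (\<Sum>\<mu>\<in>fibre (\<chi> \<nu>). Const (c \<mu>) * (entry_prod n (M \<mu>) - entry_prod n (M \<nu>)))"
      using fibre_sum[of "\<chi> \<nu>"] \<nu> by (simp add: right_diff_distrib sum_subtractf)
    also have "\<dots> \<in> J"
    proof (intro coord_ideal_sum[OF ideal] coord_ideal_mult[OF ideal] Const_in_coord_ring)
      fix \<mu> assume "\<mu> \<in> fibre (\<chi> \<nu>)"
      then have "\<mu> \<in> K" "param_char (M \<mu>) = param_char (M \<nu>)"
        by (auto simp: fibre_def \<chi>_def)
      with M \<nu> show "entry_prod n (M \<mu>) - entry_prod n (M \<nu>) \<in> J"
        by (intro entry_prod_cong[OF ideal minors] param_char_inj) (auto simp: K_def)
    qed
    finally show ?thesis .
  qed
  then have "(\<Sum>g\<in>\<chi> ` K. \<Sum>\<mu>\<in>fibre g. Const (c \<mu>) * entry_prod n (M \<mu>)) \<in> J"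
    by - (rule coord_ideal_sum[OF ideal], auto)
  also have "(\<Sum>g\<in>\<chi> ` K. \<Sum>\<mu>\<in>fibre g. Const (c \<mu>) * entry_prod n (M \<mu>)) = P"
    by (subst P_eq, unfold fibre_def K_def[symmetric], rule sum.image_gen[symmetric]) simp
  finally show ?thesis .
qed

text \<open>At a network the flattening is the outer product of \<open>a\<close> with the vector of
  entries \<open>b (l div n) * a (l mod n)\<close>, so the two terms of each minor cancel.\<close>

lemma minor_vanishes_on_neuromanifold:
  assumes "F \<in> neuromanifold [n, 1, m] 2" "P \<in> minors 2 (generic_flattening n m)"
  shows "eval (coeffs F) P = 0"
proof -
  obtain a b where ab:
    "\<And>k i j. k < m \<Longrightarrow> i < n \<Longrightarrow> j < n \<Longrightarrow> quad_mat n (F $ k) $$ (i, j) = b k * a i * a j"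
    using assms(1) unfolding neuromanifold_iff by blast
  have ent: "eval (coeffs F) (generic_flattening n m $$ (i, l)) = b (l div n) * a i * a (l mod n)"
    if "i < n" "l < n * m" for i l
  proof -
    have "n > 0" using that by simp
    then have "l mod n < n" "l div n < m" using that(2)
      by (simp_all add: div_less_iff_less_mult mult.commute)
    with that show ?thesis
      using eval_entry[of i n "l mod n" F "l div n"] ab
      by (simp add: entry_def generic_flattening_def)
  qed
  have "dim_row (generic_flattening n m) = n" "dim_col (generic_flattening n m) = n * m"
    by (simp_all add: generic_flattening_def)
  with assms(2) show ?thesis
    by (auto simp: minors_2 eval_diff eval_mult ent)
qed

text \<open>Vanishing of the minors gives the exchange relation between the numerical matrix
  entries, and symmetry then yields the common factor. This exhibits the neuromanifold as Zariski
  closed.\<close>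

lemma neuromanifold_eq_zero_set:
  "neuromanifold [n, 1, m] 2 = {F \<in> Sym_tuples n 2 m.
    \<forall>P\<in>minors 2 (generic_flattening n m). eval (coeffs F) P = 0}"
proof (intro equalityI subsetI)
  fix F assume "F \<in> neuromanifold [n, 1, m] 2"
  then show "F \<in> {F \<in> Sym_tuples n 2 m. \<forall>P\<in>minors 2 (generic_flattening n m). eval (coeffs F) P = 0}"
    using minor_vanishes_on_neuromanifold neuromanifold_Sym_tuples by blast
next
  fix F assume F: "F \<in> {F \<in> Sym_tuples n 2 m.
    \<forall>P\<in>minors 2 (generic_flattening n m). eval (coeffs F) P = 0}"
  define G where "G k i j = quad_mat n (F $ k) $$ (i, j)" for k i j
  have "G k i j * G l i' j' = G l i j' * G k i' j"
    if "k < m" "l < m" "i < n" "i' < n" "j < n" "j' < n" for k l i i' j j'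
  proof -
    \<comment> \<open>Taking the kernel of evaluation at \<open>F\<close> reuses the exchange
      relation derived for generic entries.\<close>
    let ?J = "{P. eval (coeffs F) P = 0}"
    have "entry n (k, i, j) * entry n (l, i', j') - entry n (k, i', j) * entry n (l, i, j') \<in> ?J"
      using F that
      by (intro minors_generic_flattening_subsetD[of n m ?J]) (auto simp: eval_zero eval_uminus)
    then show ?thesis
      using that by (simp add: eval_diff eval_mult eval_entry G_def mult.commute)
  qed
  moreover have "G k i j = G k j i" if "i < n" "j < n" for k i j
    using that by (simp add: G_def quad_mat_def quad_monomial_commute)
  ultimately have "\<exists>a b. \<forall>k<m. \<forall>i<n. \<forall>j<n. G k i j = b k * a i * a j"
    by (intro common_rank_one_factor)
  with F show "F \<in> neuromanifold [n, 1, m] 2"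
    by (simp add: neuromanifold_iff[simplified] G_def)
qed

lemma ideal_vanishing_ideal: "ideal (vanishing_ideal n D m Z) (coord_ring n D m)"
proof (rule idealI)
  interpret cring "coord_ring n D m" by (rule cring_coord_ring)
  show "ring (coord_ring n D m)" by (rule ring_axioms)
  show "subgroup (vanishing_ideal n D m Z) (add_monoid (coord_ring n D m))"
  proof (rule add.subgroupI)
    show "vanishing_ideal n D m Z \<subseteq> carrier (coord_ring n D m)"
      by (auto simp: vanishing_ideal_def)
    show "vanishing_ideal n D m Z \<noteq> {}"
      using zero_closed by (auto simp: vanishing_ideal_def coord_ring_simps eval_zero)
    fix P Q assume P: "P \<in> vanishing_ideal n D m Z" and Q: "Q \<in> vanishing_ideal n D m Z"
    from P have P': "P \<in> carrier (coord_ring n D m)" by (simp add: vanishing_ideal_def)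
    have "\<ominus>\<^bsub>coord_ring n D m\<^esub> P = - P"
      using P' uminus_in_coord_ring[OF P']
      by (intro minus_equality) (auto simp: coord_ring_simps)
    then show "\<ominus>\<^bsub>coord_ring n D m\<^esub> P \<in> vanishing_ideal n D m Z"
      using P uminus_in_coord_ring by (auto simp: vanishing_ideal_def eval_uminus)
    show "P \<oplus>\<^bsub>coord_ring n D m\<^esub> Q \<in> vanishing_ideal n D m Z"
      using P Q coord_ring_closed(1) by (auto simp: vanishing_ideal_def coord_ring_simps eval_add)
  qed
next
  fix P Q assume "P \<in> vanishing_ideal n D m Z" "Q \<in> carrier (coord_ring n D m)"
  then show "Q \<otimes>\<^bsub>coord_ring n D m\<^esub> P \<in> vanishing_ideal n D m Z"
    "P \<otimes>\<^bsub>coord_ring n D m\<^esub> Q \<in> vanishing_ideal n D m Z"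
    using coord_ring_closed(2) by (auto simp: vanishing_ideal_def coord_ring_simps eval_mult)
qed

lemma neurovariety_eq_neuromanifold:
  "neurovariety [n, 1, m] 2 = neuromanifold [n, 1, m] 2"
proof -
  have "zariski_closed n 2 m (neuromanifold [n, 1, m] 2)"
    unfolding zariski_closed_def neuromanifold_eq_zero_set using minors_in_coord_ring by blast
  then show ?thesis
    unfolding neurovariety_def by (intro hull_same) simp
qed

lemma vanishing_ideal_neuromanifold:
  "vanishing_ideal n 2 m (neuromanifold [n, 1, m] 2) =
    Idl\<^bsub>coord_ring n 2 m\<^esub> (minors 2 (generic_flattening n m))" (is "?V = ?I")
proof
  interpret cring "coord_ring n 2 m" by (rule cring_coord_ring)
  show "?V \<subseteq> ?I"
    using vanishing_on_neuromanifold_in_ideal[OF genideal_ideal genideal_self]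
      minors_in_coord_ring by (auto simp: vanishing_ideal_def)
  show "?I \<subseteq> ?V"
    using minors_in_coord_ring minor_vanishes_on_neuromanifold
    by (intro genideal_minimal ideal_vanishing_ideal) (auto simp: vanishing_ideal_def)
qed

theorem lemma3p4:
  fixes d0 d2 :: nat
  assumes "d0 > 0" and "d2 > 0"
  shows "map_vec (quad_mat d0) ` neuromanifold [d0, 1, d2] 2 =
      {A \<in> carrier_vec d2.
        (\<forall>k<d2. A $ k \<in> carrier_mat d0 d0 \<and> transpose_mat (A $ k) = A $ k \<and>
           mat_rank (A $ k) \<le> 1) \<and>
        (\<forall>k<d2. \<forall>l<d2. mat_rank (A $ k) = 1 \<and> mat_rank (A $ l) = 1 \<longrightarrow>
           (\<exists>c. A $ k = c \<cdot>\<^sub>m A $ l))} \<and>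
    neuromanifold [d0, 1, d2] 2 = neurovariety [d0, 1, d2] 2 \<and>
    neurovariety_ideal [d0, 1, d2] 2 =
      Idl\<^bsub>coord_ring d0 2 d2\<^esub> (minors 2 (generic_flattening d0 d2))"
proof -
  have "neurovariety_ideal [d0, 1, d2] 2 = vanishing_ideal d0 2 d2 (neuromanifold [d0, 1, d2] 2)"
    unfolding neurovariety_ideal_def neurovariety_eq_neuromanifold by simp
  then show ?thesis
    by (simp only: image_quad_mat_neuromanifold neurovariety_eq_neuromanifold
        vanishing_ideal_neuromanifold simp_thms)
qed

end
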